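(* Let $n\ge 1$ and let $t,a,b,c,d$ be complex parameters of modulus less than $1$. Then $$\int_{T} \tilde \Delta_{K}^{(n)}(z;t;a,b,c,d)\, dT = \prod_{i=0}^{n-1} \frac{1}{(1-t^{i}ac)(1-t^{i}bc)(1-t^{i}cd)(1-t^{i}ad)(1-t^{i}bd)(1-t^{i}ab)}\ \prod_{j=0}^{n-1} (1-t^{2n-2-j}abcd)\ \prod_{j=1}^{n} \frac{1-t}{1-t^{j}} .$$
   Context: $T=T_n=\{(z_1,\dots,z_n):|z_1|=\dots=|z_n|=1\}$ is the $n$-torus and $dT=\prod_{j=1}^n\frac{dz_j}{2\pi\sqrt{-1}\,z_j}$ is normalized Haar measure. The symmetric Koornwinder density at $q=0$ is $$\tilde \Delta_{K}^{(n)}(z;t;t_{0},t_{1},t_{2},t_{3}) = \frac{1}{2^{n}n!} \prod_{1 \leq i \leq n} \frac{(1-z_{i}^{\pm 2})}{(1-t_{0}z_{i}^{\pm 1})(1-t_{1}z_{i}^{\pm 1})(1-t_{2}z_{i}^{\pm 1})(1-t_{3}z_{i}^{\pm 1})} \prod_{1 \leq i<j \leq n} \frac{(1-z_{i}^{\pm 1}z_{j}^{\pm 1})}{(1-tz_{i}^{\pm 1}z_{j}^{\pm 1})},$$ where a factor with $\pm$ exponents denotes the product over all sign choices, e.g. $(1-z_i^{\pm2})=(1-z_i^2)(1-z_i^{-2})$ and $(1-z_{i}^{\pm 1}z_{j}^{\pm 1})=(1-z_{i}z_{j})(1-z_{i}^{-1}z_{j}^{-1})(1-z_{i}^{-1}z_{j})(1-z_{i}z_{j}^{-1})$.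 *)

theory Defs
  imports "HOL-Analysis.Analysis" "HOL-Complex_Analysis.Complex_Analysis"
begin

text \<open>
  The normalized Haar measure on the unit circle, as a measure whose underlying space is
  the circle itself: the image of Lebesgue measure on the unit interval
  under \<open>\<theta> \<mapsto> exp (2 \<pi> i \<theta>)\<close>, i.e.\ the measure \<open>dz / (2 \<pi> i z)\<close>; see
  \<open>integral_circle_measure\<close> below.
\<close>

definition circle_measure :: "complex measure" where
  "circle_measure =
     distr (restrict_space lborel {0..1}) (restrict_space borel (sphere 0 1))
       (\<lambda>\<theta>. cis (2 * pi * \<theta>))"

text \<open>
  Points of the \<open>n\<close>-torus are functions \<open>z\<close> on the index set \<open>{1..n}\<close> (extensional,
  i.e.\ \<open>undefined\<close> outside of it).
\<close>

definition torus :: "nat \<Rightarrow> (nat \<Rightarrow> complex) set" where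
  "torus n = (\<Pi>\<^sub>E j\<in>{1..n}. sphere 0 1)"

definition torus_measure :: "nat \<Rightarrow> (nat \<Rightarrow> complex) measure" where
  "torus_measure n = (\<Pi>\<^sub>M j\<in>{1..n}. circle_measure)"

definition koornwinder_density ::
    "nat \<Rightarrow> (nat \<Rightarrow> complex) \<Rightarrow> complex \<Rightarrow> complex \<Rightarrow> complex \<Rightarrow> complex \<Rightarrow> complex \<Rightarrow> complex" where
  "koornwinder_density n z t t0 t1 t2 t3 =
     1 / (2 ^ n * fact n) *
     (\<Prod>i\<in>{1..n}.
        ((1 - z i ^ 2) * (1 - inverse (z i) ^ 2)) /
        (((1 - t0 * z i) * (1 - t0 * inverse (z i))) *
         ((1 - t1 * z i) * (1 - t1 * inverse (z i))) *
         ((1 - t2 * z i) * (1 - t2 * inverse (z i))) *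
         ((1 - t3 * z i) * (1 - t3 * inverse (z i))))) *
     (\<Prod>(i, j)\<in>{(i, j). 1 \<le> i \<and> i < j \<and> j \<le> n}.
        ((1 - z i * z j) * (1 - inverse (z i) * inverse (z j)) *
         (1 - inverse (z i) * z j) * (1 - z i * inverse (z j))) /
        ((1 - t * z i * z j) * (1 - t * inverse (z i) * inverse (z j)) *
         (1 - t * inverse (z i) * z j) * (1 - t * z i * inverse (z j))))"

lemma measurable_cis_circle:
  "(\<lambda>\<theta>. cis (2 * pi * \<theta>)) \<in> restrict_space lborel {0..1} \<rightarrow>\<^sub>M restrict_space borel (sphere 0 1)"
  by (intro measurable_restrict_space2 measurable_restrict_space1)
     (auto intro!: borel_measurable_continuous_onI continuous_intros)

lemma space_circle_measure: "space circle_measure = sphere 0 1"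
  by (simp add: circle_measure_def space_restrict_space)

lemma emeasure_circle_measure: "emeasure circle_measure (sphere 0 1) = 1"
proof -
  have "(\<lambda>\<theta>. cis (2 * pi * \<theta>)) -` sphere 0 1 \<inter> {0..1} = {0..1::real}"
    by auto
  then show ?thesis
    unfolding circle_measure_def
    by (subst emeasure_distr[OF measurable_cis_circle])
       (auto simp: sets_restrict_space space_restrict_space emeasure_restrict_space)
qed

lemma space_torus_measure: "space (torus_measure n) = torus n"
  by (simp add: torus_measure_def torus_def space_PiM space_circle_measure)

lemma integral_circle_measure:
  assumes "continuous_on (sphere 0 1) f"
  shows "(LINT z|circle_measure. f z) =
    contour_integral (circlepath 0 1) (\<lambda>z. f z / (2 * pi * \<i> * z))"
proof -
  have cont: "continuous_on {0..1} (\<lambda>\<theta>. f (cis (2 * pi * \<theta>)))"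
    by (rule continuous_on_compose2[OF assms]) (auto intro!: continuous_intros)
  have meas: "f \<in> borel_measurable (restrict_space borel (sphere 0 1))"
    using assms by (rule borel_measurable_continuous_on_restrict)
  have "(LINT z|circle_measure. f z) =
      (LINT \<theta>|restrict_space lborel {0..1}. f (cis (2 * pi * \<theta>)))"
    unfolding circle_measure_def by (rule integral_distr[OF measurable_cis_circle meas])
  also have "\<dots> = (LINT \<theta>:{0..1}|lborel. f (cis (2 * pi * \<theta>)))"
    unfolding set_lebesgue_integral_def by (rule integral_restrict_space) auto
  also have "\<dots> = integral {0..1} (\<lambda>\<theta>. f (cis (2 * pi * \<theta>)))"
    by (rule set_borel_integral_eq_integral(2)[OF borel_integrable_atLeastAtMost'[OF cont]])
  also have "\<dots> = contour_integral (circlepath 0 1) (\<lambda>z. f z / (2 * pi * \<i> * z))"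
    unfolding contour_integral_integral vector_derivative_circlepath
    by (rule integral_cong) (auto simp: circlepath cis_conv_exp mult_ac)
  finally show ?thesis .
qed

end

theory Submission
  imports Defs
begin

text \<open>
The integral is computed by integrating out one variable at a time. A variable that occurs
in the density with all its pair factors cannot be integrated directly, because the factors
\<open>1 - t / (z\<^sub>k z\<^sub>j)\<close> and \<open>1 - t z\<^sub>j / z\<^sub>k\<close> contribute poles inside the unit circle. Write
\<open>h(x, y) = (1 - x y) (1 - x / y) / ((1 - t x y) (1 - t x / y))\<close>, so that the pair factor of \<open>z\<^sub>k\<close> and
\<open>z\<^sub>j\<close> is \<open>h(z\<^sub>k, z\<^sub>j) h(1 / z\<^sub>k, z\<^sub>j)\<close>. One half of each pair factor of one variable can be
removed by symmetrization: for \<open>n\<close> variables,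
\<open>(\<Sum>k. (\<Prod>j\<noteq>k. 1 / h(z\<^sub>k, z\<^sub>j)) + (\<Prod>j\<noteq>k. 1 / h(1 / z\<^sub>k, z\<^sub>j))) = (1 + t\<^sup>n\<^sup>-\<^sup>1) (1 - t\<^sup>n) / (1 - t)\<close>.
This is the step from \<open>n - 1\<close> to \<open>n\<close> in Macdonald's sum over the hyperoctahedral group, and
it is proved as a residue sum, in the form of the interpolation formula
\<open>sum_over_simple_nodes_eq_coeff\<close> (\<open>sum_inverse_half_kernels\<close>, \<open>bc_density_symmetrization\<close>).

After multiplication by the density, the summand of \<open>k\<close> contains \<open>z\<^sub>k\<close> only through its one-variable
weight and the factors \<open>h(z\<^sub>k, z\<^sub>j)\<close> (or \<open>h(1 / z\<^sub>k, z\<^sub>j)\<close>, which has the same integral). Inside the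
unit circle the only poles in \<open>z\<^sub>k\<close> are now the four parameters (\<open>circle_integral_by_residues\<close>). The
residue at \<open>a\<close> multiplies the density of the remaining variables by \<open>\<Prod>j. h(a, z\<^sub>j)\<close>, and this
product turns it into the density with \<open>t a\<close> in place of \<open>a\<close>: the numerator of \<open>h(a, z\<^sub>j)\<close>
cancels the factors of \<open>a\<close>, and its denominator supplies those of \<open>t a\<close> (\<open>bc_density_shift\<close>). Hence the
\<open>n\<close>-variable integral is a combination of four \<open>(n - 1)\<close>-variable integrals
(\<open>bc_density_integral_recursion\<close>). The product formula satisfies the same recursion; this reduces to
a rational identity in \<open>a, b, c, d\<close> and \<open>s = t\<^sup>n\<^sup>-\<^sup>1\<close>
(\<open>four_parameter_sum\<close>, \<open>sum_site_residues_gustafson\<close>).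

Simple poles require \<open>a, b, c, d\<close> to be distinct, and the interpolation nodes \<open>0, \<surd>t, - \<surd>t\<close> require
\<open>t \<noteq> 0\<close>. Both restrictions are removed within the induction by dominated convergence, so that the
induction hypothesis covers parameters such as \<open>t a, b, c, d\<close> that may coincide.
\<close>

section \<open>Summation over simple nodes\<close>

text \<open>
The left-hand side is the leading coefficient of the Lagrange interpolation polynomial of \<open>p\<close> at
the nodes \<open>X\<close>, which equals \<open>p\<close> because the degree is small enough. Equivalently, it is the sum of
the residues of \<open>p(x) / (\<Prod>y\<in>X. x - y)\<close>, which is what the formula is used for.
\<close>

lemma sum_over_simple_nodes_eq_coeff:
  fixes p :: "'a::field poly"
  assumes "finite X" "degree p < card X"
  shows "(\<Sum>x\<in>X. poly p x / (\<Prod>y\<in>X-{x}. x - y)) = coeff p (card X - 1)"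
proof -
  define L where "L x = (\<Prod>y\<in>X-{x}. [:-y, 1:])" for x
  define q where "q = (\<Sum>x\<in>X. smult (poly p x / (\<Prod>y\<in>X-{x}. x - y)) (L x))"
  have degL: "degree (L x) = card X - 1" if "x \<in> X" for x
    using that assms by (simp add: L_def degree_prod_eq_sum_degree)
  have leadL: "coeff (L x) (card X - 1) = 1" if "x \<in> X" for x
    using degL[OF that] lead_coeff_prod[of "\<lambda>y. [:-y, 1:]" "X-{x}"] by (simp add: L_def)
  have L_at: "poly (L x) w = (\<Prod>y\<in>X-{x}. w - y)" for x w
    by (simp add: L_def poly_prod)
  have "degree q \<le> card X - 1"
    unfolding q_def by (rule degree_sum_le) (use assms degL in auto)
  then have deg: "degree (p - q) < card X"
    using assms by (intro degree_diff_less) linarith+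
  have "poly (p - q) w = 0" if w: "w \<in> X" for w
  proof -
    have "poly q w = (\<Sum>x\<in>X. poly p x / (\<Prod>y\<in>X-{x}. x - y) * (\<Prod>y\<in>X-{x}. w - y))"
      by (simp add: q_def poly_sum L_at)
    also have "\<dots> = (\<Sum>x\<in>X. if x = w then poly p w else 0)"
    proof (rule sum.cong[OF refl])
      fix x assume x: "x \<in> X"
      have "(\<Prod>y\<in>X-{w}. w - y) \<noteq> 0"
        using assms by (auto simp: prod_zero_iff)
      moreover have "(\<Prod>y\<in>X-{x}. w - y) = 0" if "x \<noteq> w"
        using assms w that by (auto simp: prod_zero_iff)
      ultimately show "poly p x / (\<Prod>y\<in>X-{x}. x - y) * (\<Prod>y\<in>X-{x}. w - y)
          = (if x = w then poly p w else 0)" by auto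
    qed
    also have "\<dots> = poly p w" using assms w by simp
    finally show ?thesis by simp
  qed
  then have "X \<subseteq> {w. poly (p - q) w = 0}" by auto
  have "p - q = 0"
  proof (rule ccontr)
    assume nz: "p - q \<noteq> 0"
    have "card X \<le> card {w. poly (p - q) w = 0}"
      by (rule card_mono[OF poly_roots_finite[OF nz]]) fact
    also have "\<dots> \<le> degree (p - q)" by (rule card_poly_roots_bound[OF nz])
    finally show False using deg by simp
  qed
  then have "coeff p (card X - 1) = coeff q (card X - 1)" by simp
  also have "\<dots> = (\<Sum>x\<in>X. poly p x / (\<Prod>y\<in>X-{x}. x - y))"
    unfolding q_def coeff_sum by (intro sum.cong) (simp_all add: leadL del: One_nat_def)
  finally show ?thesis ..
qed

section \<open>The hyperoctahedral symmetrization of the pair factors\<close>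

text \<open>
The sign choices of the pair factor are split by the exponent of \<open>x\<close>: the factors with \<open>x\<close>
are here, those with \<open>1 / x\<close> are \<open>half_kernel t (inverse x) y\<close>. For \<open>\<bar>t\<bar> < 1\<close> and \<open>y\<close>
on the unit circle this half is holomorphic in \<open>x\<close> on the closed unit disc.
\<close>

definition half_kernel :: "complex \<Rightarrow> complex \<Rightarrow> complex \<Rightarrow> complex" where
  "half_kernel t x y = ((1 - x * y) * (1 - x * inverse y)) / ((1 - t * x * y) * (1 - t * x * inverse y))"

text \<open>
Let \<open>U\<close> be the set of the \<open>2 n\<close> points \<open>z\<^sub>k\<close> and \<open>1 / z\<^sub>k\<close>. The summand that belongs to \<open>u \<in> U\<close> omits
the factor of \<open>v = 1 / u\<close> from \<open>\<Prod>v. (u - t v) / (u - v)\<close>, that is, it carries the extra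
factor \<open>(u\<^sup>2 - 1) / (u\<^sup>2 - t)\<close>. So, up to the factor \<open>1 - t\<close>, the sum consists of residues of
\<open>(x\<^sup>2 - 1) / (x (x\<^sup>2 - t)) * (\<Prod>v\<in>U. (x - t v) / (x - v))\<close>, whose other finite poles are \<open>0\<close> and
\<open>\<plusminus> \<surd>t\<close>. At \<open>x\<^sup>2 = t\<close> the product over \<open>U\<close> collapses to \<open>t\<^sup>n\<close>, because
\<open>(x - t v) (x - t / v) = t (x - v) (x - 1 / v)\<close> there. The sum of all
residues is the leading coefficient \<open>1\<close>.
\<close>

lemma sum_inverse_half_kernels:
  fixes z :: "'i \<Rightarrow> complex"
  assumes "finite I" "I \<noteq> {}" and t: "t \<noteq> 0" "norm t < 1"
    and circle: "\<And>k. k \<in> I \<Longrightarrow> norm (z k) = 1"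
    and inj: "inj_on z I" and no_pair: "\<And>k j. k \<in> I \<Longrightarrow> j \<in> I \<Longrightarrow> z k * z j \<noteq> 1"
  shows "(1 - t) * (\<Sum>k\<in>I. (\<Prod>j\<in>I-{k}. inverse (half_kernel t (z k) (z j)))
                        + (\<Prod>j\<in>I-{k}. inverse (half_kernel t (inverse (z k)) (z j))))
       = (1 + t ^ (card I - 1)) * (1 - t ^ card I)"
proof -
  define r where "r = csqrt t"
  have r2: "r * r = t" by (metis power2_csqrt power2_eq_square r_def)
  have r0: "r \<noteq> 0" using t r2 by auto
  have nr: "norm r < 1"
    using t r2 by (metis norm_mult norm_ge_zero abs_square_less_1 abs_of_nonneg power2_eq_square)
  define A where "A = z ` I"
  define B where "B = (\<lambda>k. inverse (z k)) ` I"
  \<comment> \<open>the poles of the rational function; \<open>r\<close> is a square root of \<open>t\<close>\<close>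
  define X where "X = {0, r, -r} \<union> (A \<union> B)"
  have z0: "z k \<noteq> 0" if "k \<in> I" for k using circle[OF that] by auto
  have norms: "norm y = 1" if "y \<in> A \<union> B" for y
    using that circle by (auto simp: A_def B_def norm_inverse)
  have injB: "inj_on (\<lambda>k. inverse (z k)) I" using inj by (auto simp: inj_on_def)
  have AB: "A \<inter> B = {}"
    using no_pair z0 by (fastforce simp: A_def B_def field_simps)
  have small: "{0, r, -r} \<inter> (A \<union> B) = {}" using norms nr by force
  have fin: "finite A" "finite B" "finite X" using assms by (auto simp: A_def B_def X_def)
  have rr: "r \<noteq> - r" "0 \<noteq> r" "0 \<noteq> -r" using r0 by auto
  \<comment> \<open>with \<open>f\<close> equal to \<open>1\<close> at a node \<open>u\<close> itself, this one formula evaluates \<open>D u\<close> below for every node\<close>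
  have prod_X: "(\<Prod>y\<in>X. f y) = f 0 * (f r * f (-r)) * (\<Prod>j\<in>I. f (z j) * f (inverse (z j)))"
    for f :: "complex \<Rightarrow> complex"
    unfolding X_def using fin AB small rr
    by (simp add: prod.union_disjoint prod.distrib A_def B_def prod.reindex[OF inj] prod.reindex[OF injB]
        del: Un_insert_left)
  have sum_X: "(\<Sum>y\<in>X. f y) = f 0 + (f r + f (-r)) + (\<Sum>j\<in>I. f (z j) + f (inverse (z j)))"
    for f :: "complex \<Rightarrow> complex"
    unfolding X_def using fin AB small rr
    by (simp add: sum.union_disjoint sum.distrib A_def B_def sum.reindex[OF inj] sum.reindex[OF injB]
        del: Un_insert_left)
  have card_X: "card X = 2 * card I + 3"
    unfolding X_def using fin AB small rr
    by (simp add: card_Un_disjoint A_def B_def card_image[OF inj] card_image[OF injB] del: Un_insert_left)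
  define N where "N x = (\<Prod>j\<in>I. (x - t * z j) * (x - t * inverse (z j)))" for x
  define Q where "Q x = (\<Prod>j\<in>I. (x - z j) * (x - inverse (z j)))" for x
  define p where "p = [:-1, 0, 1:] * (\<Prod>j\<in>I. [:- (t * z j), 1:] * [:- (t * inverse (z j)), 1:])"
  have poly_p: "poly p x = (x^2 - 1) * N x" for x
    by (simp add: p_def N_def poly_prod power2_eq_square algebra_simps)
  have deg1: "degree ([:- (t * z j), 1:] * [:- (t * inverse (z j)), 1:]) = 2" for j
    by (subst degree_mult_eq) auto
  have degp: "degree p = 2 * card I + 2"
    unfolding p_def by (subst degree_mult_eq) (auto simp: degree_prod_eq_sum_degree deg1 assms(1) simp del: mult_pCons_left mult_pCons_right)
  have "lead_coeff p = 1" unfolding p_def by (simp add: lead_coeff_mult lead_coeff_prod del: mult_pCons_left mult_pCons_right)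
  then have coeffp: "coeff p (card X - 1) = 1" by (simp add: degp card_X)
  define D where "D u = (\<Prod>y\<in>X-{u}. u - y)" for u
  have D: "D u = (\<Prod>y\<in>X. if y = u then 1 else u - y)" if "u \<in> X" for u
    unfolding D_def using fin(3) that by (auto simp: prod.remove[of X u "\<lambda>y. if y = u then 1 else u - y"] intro: prod.cong)
  have main: "(\<Sum>x\<in>X. poly p x / D x) = 1"
    unfolding D_def coeffp[symmetric]
    by (rule sum_over_simple_nodes_eq_coeff) (use fin in \<open>simp_all add: card_X degp\<close>)
  have inX: "0 \<in> X" "r \<in> X" "-r \<in> X" by (auto simp: X_def)
  have neq: "z j \<noteq> r" "z j \<noteq> -r" "inverse (z j) \<noteq> r" "inverse (z j) \<noteq> -r" "z j \<noteq> 0" if "j \<in> I" for j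
    using that nr circle[OF that] by (auto simp: norm_inverse norm_minus_cancel dest: arg_cong[where f=norm])
  have npos: "card I > 0" using assms by (simp add: card_gt_0_iff)
  then obtain m where m: "card I = Suc m" by (cases "card I") auto
  have at0: "poly p 0 / D 0 = t ^ (2 * card I - 1)"
  proof -
    have "D 0 = - t * (\<Prod>j\<in>I. 1)"
      unfolding D[OF inX(1)] prod_X using neq r0 r2 by (auto intro!: prod.cong)
    moreover have "N 0 = (t * t) ^ card I"
      unfolding N_def using neq by (subst prod_constant[symmetric], intro prod.cong) auto
    ultimately show ?thesis using t
      by (simp add: poly_p m power_mult_distrib mult_2 power_add)
  qed
  have NQ: "N x = t ^ card I * Q x" if "x * x = t" for x
    unfolding N_def Q_def prod_constant[symmetric] prod.distrib[symmetric]
  proof (rule prod.cong[OF refl])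
    fix j assume "j \<in> I"
    then have "z j * inverse (z j) = 1" using z0 by simp
    then show "(x - t * z j) * (x - t * inverse (z j)) = t * ((x - z j) * (x - inverse (z j)))"
      using that by algebra
  qed
  \<comment> \<open>the two roots together contribute \<open>(t - 1) t\<^sup>n\<^sup>-\<^sup>1\<close>\<close>
  have at_root: "poly p x / D x = (t - 1) * t ^ (card I - 1) / 2" if x: "x = r \<or> x = -r" for x
  proof -
    have xx: "x * x = t" using x r2 by auto
    have xX: "x \<in> X" using x by (auto simp: X_def)
    have "D x = 2 * t * Q x"
      unfolding D[OF xX] prod_X Q_def using x neq r0 r2 by (auto intro!: prod.cong)
    moreover have "Q x \<noteq> 0"
      unfolding Q_def prod_zero_iff[OF assms(1)] using x neq by fastforce
    ultimately show ?thesis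
      using t NQ[OF xx] xx by (simp add: poly_p m power2_eq_square)
  qed
  have at_u: "poly p u / D u = (1 - t) * (\<Prod>j\<in>I-{k}. inverse (half_kernel t (inverse u) (z j)))"
    if k: "k \<in> I" and u: "u = z k \<or> u = inverse (z k)" for u k
  proof -
    have uX: "u \<in> X" and u0: "u \<noteq> 0" and un: "norm u = 1"
      using k u z0 circle by (auto simp: X_def A_def B_def norm_inverse)
    have "u * u \<noteq> 1"
      using no_pair[OF k k] u by (auto simp flip: inverse_mult_distrib)
    moreover have "u * u \<noteq> t"
      using t un norm_mult[of u u] by auto
    ultimately have uu: "u * u \<noteq> 1" "u * u \<noteq> t" .
    have other: "z j \<noteq> u" "inverse (z j) \<noteq> u" if "j \<in> I - {k}" for j
    proof -
      have "z j \<noteq> z k" using that k inj by (auto simp: inj_on_def)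
      moreover have "z j \<noteq> inverse (z k)" "z k \<noteq> inverse (z j)"
        using that k no_pair[of j k] no_pair[of k j] z0[of j] z0[of k] by auto
      ultimately show "z j \<noteq> u" "inverse (z j) \<noteq> u" using u by auto
    qed
    have Du: "D u = u * (u * u - t) * ((u - inverse u) * (\<Prod>j\<in>I-{k}. (u - z j) * (u - inverse (z j))))"
    proof -
      have "inverse u \<noteq> u" using uu u0 by (metis right_inverse)
      then have "(if z k = u then 1 else u - z k) * (if inverse (z k) = u then 1 else u - inverse (z k)) = u - inverse u"
        using u by auto
      then have all: "(\<Prod>j\<in>I. (if z j = u then 1 else u - z j) * (if inverse (z j) = u then 1 else u - inverse (z j)))
          = (u - inverse u) * (\<Prod>j\<in>I-{k}. (u - z j) * (u - inverse (z j)))"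
        using assms(1) k other by (subst prod.remove[of I k]) (auto intro!: prod.cong)
      have "u \<noteq> r" "u \<noteq> -r" using un nr by auto
      moreover have "(u - r) * (u - -r) = u * u - t" using r2 by (simp add: algebra_simps)
      ultimately show ?thesis
        unfolding D[OF uX] prod_X all using u0 by auto
    qed
    have Nu: "N u = (1 - t) * u * (u - t * inverse u) * (\<Prod>j\<in>I-{k}. (u - t * z j) * (u - t * inverse (z j)))"
      unfolding N_def using assms(1) k u by (subst prod.remove[of I k]) (auto simp: algebra_simps)
    have hu: "(\<Prod>j\<in>I-{k}. inverse (half_kernel t (inverse u) (z j)))
      = (\<Prod>j\<in>I-{k}. (u - t * z j) * (u - t * inverse (z j))) / (\<Prod>j\<in>I-{k}. (u - z j) * (u - inverse (z j)))"
      unfolding prod_dividef[symmetric]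
    proof (rule prod.cong[OF refl])
      fix j assume j: "j \<in> I - {k}"
      have quot: "1 - inverse u * v = (u - v) / u" "1 - t * inverse u * v = (u - t * v) / u" for v
        using u0 by (simp_all add: field_simps)
      then show "inverse (half_kernel t (inverse u) (z j))
         = (u - t * z j) * (u - t * inverse (z j)) / ((u - z j) * (u - inverse (z j)))"
        unfolding half_kernel_def quot using u0 by simp
    qed
    have exch: "(u^2 - 1) * ((1 - t) * u * (u - t * inverse u)) = (1 - t) * (u * (u * u - t) * (u - inverse u))"
      using u0 by (simp add: field_simps power2_eq_square)
    have nz: "u * (u * u - t) * (u - inverse u) \<noteq> 0"
    proof -
      have "(u * u - t) * (u * u - 1) \<noteq> 0" using uu by simp
      also have "(u * u - t) * (u * u - 1) = u * (u * u - t) * (u - inverse u)"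
        using u0 by (simp add: field_simps)
      finally show ?thesis .
    qed
    let ?num = "\<Prod>j\<in>I-{k}. (u - t * z j) * (u - t * inverse (z j))"
    let ?den = "\<Prod>j\<in>I-{k}. (u - z j) * (u - inverse (z j))"
    have "poly p u / D u = ((u^2 - 1) * ((1 - t) * u * (u - t * inverse u))) * ?num
        / ((u * (u * u - t) * (u - inverse u)) * ?den)"
      unfolding poly_p Nu Du by (simp only: mult.assoc)
    also have "\<dots> = (1 - t) * (?num / ?den)"
      unfolding exch using nz by (simp del: mult_eq_0_iff add: mult.assoc)
    finally show ?thesis unfolding hu .
  qed
  have "(\<Sum>x\<in>X. poly p x / D x) = t ^ (2 * card I - 1) + (t - 1) * t ^ (card I - 1)
     + (1 - t) * (\<Sum>k\<in>I. (\<Prod>j\<in>I-{k}. inverse (half_kernel t (z k) (z j)))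
                        + (\<Prod>j\<in>I-{k}. inverse (half_kernel t (inverse (z k)) (z j))))"
    unfolding sum_X sum_distrib_left at0
  proof (intro arg_cong2[where f = "(+)"] refl sum.cong)
    show "poly p r / D r + poly p (- r) / D (- r) = (t - 1) * t ^ (card I - 1)"
      by (simp add: at_root)
  next
    fix k assume k: "k \<in> I"
    show "poly p (z k) / D (z k) + poly p (inverse (z k)) / D (inverse (z k))
       = (1 - t) * ((\<Prod>j\<in>I-{k}. inverse (half_kernel t (z k) (z j)))
                   + (\<Prod>j\<in>I-{k}. inverse (half_kernel t (inverse (z k)) (z j))))"
      using at_u[OF k, of "z k"] at_u[OF k, of "inverse (z k)"]
      by (simp only: inverse_inverse_eq distrib_left simp_thms) simp
  qed
  then show ?thesis
    using main by (simp add: m algebra_simps power_mult power2_eq_square)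
qed

definition site_weight :: "complex \<Rightarrow> complex \<Rightarrow> complex \<Rightarrow> complex \<Rightarrow> complex \<Rightarrow> complex" where
  "site_weight a b c d x =
     ((1 - x ^ 2) * (1 - inverse x ^ 2)) /
     (((1 - a * x) * (1 - a * inverse x)) * ((1 - b * x) * (1 - b * inverse x)) *
      ((1 - c * x) * (1 - c * inverse x)) * ((1 - d * x) * (1 - d * inverse x)))"

text \<open>
The density without its normalizing constant, over an arbitrary finite set of variables: removing the
variable \<open>k\<close> then leaves the density of \<open>I - {k}\<close>, and no relabelling of variables ever occurs.
\<close>

definition bc_density ::
    "nat set \<Rightarrow> complex \<Rightarrow> complex \<Rightarrow> complex \<Rightarrow> complex \<Rightarrow> complex \<Rightarrow> (nat \<Rightarrow> complex) \<Rightarrow> complex" where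
  "bc_density I t a b c d z =
     (\<Prod>i\<in>I. site_weight a b c d (z i)) *
     (\<Prod>(i, j)\<in>{(i, j). i \<in> I \<and> j \<in> I \<and> i < j}.
        half_kernel t (z i) (z j) * half_kernel t (inverse (z i)) (z j))"

lemma site_weight_inverse: "site_weight a b c d (inverse x) = site_weight a b c d x"
  by (simp add: site_weight_def mult_ac)

lemma site_weight_swap:
  "site_weight a b c d x = site_weight b a c d x"
  "site_weight a b c d x = site_weight c b a d x"
  "site_weight a b c d x = site_weight d b c a x"
  by (simp_all add: site_weight_def mult_ac)

lemma bc_density_swap:
  "bc_density I t a b c d z = bc_density I t b a c d z"
  "bc_density I t a b c d z = bc_density I t c b a d z"
  "bc_density I t a b c d z = bc_density I t d b c a z"
  unfolding bc_density_def
  by (simp_all only: site_weight_swap(1)[of a b c d] simp_thms,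
      (subst site_weight_swap(1)[symmetric], subst site_weight_swap(2)[of a b c d], rule refl),
      (subst site_weight_swap(1)[symmetric], subst site_weight_swap(3)[of a b c d], rule refl))

lemma pair_weight_commute:
  "half_kernel t x y * half_kernel t (inverse x) y = half_kernel t y x * half_kernel t (inverse y) x"
  by (simp add: half_kernel_def mult_ac)

text \<open>
The pair factor is symmetric in its two variables, so the pairs that contain \<open>k\<close> can all be listed
with \<open>k\<close> first, whatever the order of the indices.
\<close>

lemma bc_density_remove:
  assumes "finite I" "k \<in> I"
  shows "bc_density I t a b c d z =
    bc_density (I - {k}) t a b c d z * site_weight a b c d (z k) *
    (\<Prod>j\<in>I-{k}. half_kernel t (z k) (z j) * half_kernel t (inverse (z k)) (z j))"
proof -
  define K where "K i j = half_kernel t (z i) (z j) * half_kernel t (inverse (z i)) (z j)" for i j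
  have K: "K i j = K j i" for i j unfolding K_def by (rule pair_weight_commute)
  define P where "P J = {(i, j). i \<in> J \<and> j \<in> J \<and> i < j}" for J :: "nat set"
  define f where "f j = (min k j, max k j)" for j
  have finP: "finite (P (I - {k}))"
    by (rule finite_subset[of _ "I \<times> I"]) (use assms in \<open>auto simp: P_def\<close>)
  have "P I = P (I - {k}) \<union> f ` (I - {k})"
  proof (intro equalityI subsetI)
    fix x assume "x \<in> P I"
    then obtain i j where x: "x = (i, j)" "i \<in> I" "j \<in> I" "i < j" by (auto simp: P_def)
    consider "i = k" | "j = k" | "i \<noteq> k" "j \<noteq> k" by blast
    then show "x \<in> P (I - {k}) \<union> f ` (I - {k})"
    proof cases
      case 1 then have "x = f j" "j \<in> I - {k}" using x by (auto simp: f_def)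
      then show ?thesis by blast
    next
      case 2 then have "x = f i" "i \<in> I - {k}" using x by (auto simp: f_def)
      then show ?thesis by blast
    next
      case 3 then show ?thesis using x by (auto simp: P_def)
    qed
  next
    fix x assume "x \<in> P (I - {k}) \<union> f ` (I - {k})"
    then show "x \<in> P I" using assms by (auto simp: P_def f_def min_def max_def)
  qed
  moreover have "P (I - {k}) \<inter> f ` (I - {k}) = {}"
    by (auto simp: P_def f_def min_def max_def split: if_splits)
  moreover have "inj_on f (I - {k})"
    by (auto simp: f_def inj_on_def min_def max_def split: if_splits)
  ultimately have "(\<Prod>(i,j)\<in>P I. K i j) = (\<Prod>(i,j)\<in>P (I - {k}). K i j) * (\<Prod>j\<in>I-{k}. case f j of (i, j) \<Rightarrow> K i j)"
    using assms finP by (simp add: prod.union_disjoint prod.reindex)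
  also have "(\<Prod>j\<in>I-{k}. case f j of (i, j) \<Rightarrow> K i j) = (\<Prod>j\<in>I-{k}. K k j)"
    by (rule prod.cong) (auto simp: f_def min_def max_def K)
  finally show ?thesis
    unfolding bc_density_def P_def[symmetric] K_def[symmetric]
    using assms by (simp add: prod.remove[of I k] mult_ac)
qed

lemma bc_density_eq_0_site:
  assumes "finite I" "k \<in> I" "z k * z k = 1"
  shows "bc_density I t a b c d z = 0"
  using assms by (simp add: bc_density_remove[OF assms(1,2)] site_weight_def power2_eq_square)

lemma half_kernel_eq_0:
  assumes "x \<noteq> 0" "y \<noteq> 0" "x = y \<or> x * y = 1"
  shows "half_kernel t x y = 0" "half_kernel t (inverse x) y = 0"
  using assms by (auto simp: half_kernel_def simp flip: inverse_mult_distrib)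

lemma bc_density_eq_0_pair:
  assumes "finite I" "k \<in> I" "j \<in> I" "k \<noteq> j" "z k \<noteq> 0" "z j \<noteq> 0" "z k = z j \<or> z k * z j = 1"
  shows "bc_density I t a b c d z = 0"
  using assms half_kernel_eq_0[of "z k" "z j" t]
  by (auto simp: bc_density_remove[OF assms(1,2)] prod_zero_iff)

lemma one_minus_nonzero: "norm (x::complex) < 1 \<Longrightarrow> 1 - x \<noteq> 0"
  by auto

text \<open>
For generic \<open>z\<close> this is \<open>sum_inverse_half_kernels\<close> multiplied by the density. At the remaining
points of the torus, where some \<open>z\<^sub>k\<^sup>2 = 1\<close> or \<open>z\<^sub>k = z\<^sub>j\<^sup>\<plusminus>\<^sup>1\<close> and the
points to be interpolated coincide, the density and every summand vanish: a summand that does not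
contain the vanishing factor in the reduced density contains it in the factors of its own variable.
The identity therefore holds at every point, not merely almost everywhere.
\<close>

lemma bc_density_symmetrization:
  assumes "finite I" "I \<noteq> {}" and t: "t \<noteq> 0" "norm t < 1"
    and circle: "\<And>k. k \<in> I \<Longrightarrow> norm (z k) = 1"
  shows "(1 + t ^ (card I - 1)) * (1 - t ^ card I) * bc_density I t a b c d z =
    (1 - t) * (\<Sum>k\<in>I. bc_density (I - {k}) t a b c d z * site_weight a b c d (z k) *
      ((\<Prod>j\<in>I-{k}. half_kernel t (z k) (z j)) + (\<Prod>j\<in>I-{k}. half_kernel t (inverse (z k)) (z j))))"
    (is "_ = _ * (\<Sum>k\<in>I. ?T k)")
proof -
  have z0: "z k \<noteq> 0" if "k \<in> I" for k using circle[OF that] by auto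
  consider (site) k where "k \<in> I" "z k * z k = 1"
    | (pair) k j where "k \<in> I" "j \<in> I" "k \<noteq> j" "z k = z j \<or> z k * z j = 1"
    | (generic) "inj_on z I" "\<And>k j. k \<in> I \<Longrightarrow> j \<in> I \<Longrightarrow> z k * z j \<noteq> 1"
    by (metis inj_onI)
  then show ?thesis
  proof cases
    case site
    have T: "?T m = 0" for m
    proof (cases "m = k")
      case True then show ?thesis using site by (simp add: site_weight_def power2_eq_square)
    next
      case False then show ?thesis using site assms(1) by (simp add: bc_density_eq_0_site[of _ k])
    qed
    have "bc_density I t a b c d z = 0"
      using site assms(1) by (simp add: bc_density_eq_0_site)
    then show ?thesis unfolding T by simp
  next
    case pair
    have zero: "?T m = 0" if "m \<in> I" "i \<in> I" "m \<noteq> i" "z m = z i \<or> z m * z i = 1" for m i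
    proof -
      have "(\<Prod>j\<in>I-{m}. half_kernel t (z m) (z j)) = 0" "(\<Prod>j\<in>I-{m}. half_kernel t (inverse (z m)) (z j)) = 0"
        using that half_kernel_eq_0[OF z0[of m] z0[of i]] assms(1) by (auto simp: prod_zero_iff)
      then show ?thesis by simp
    qed
    have T: "?T m = 0" if "m \<in> I" for m
    proof -
      consider "m = k" | "m = j" | "m \<noteq> k" "m \<noteq> j" by blast
      then show ?thesis
      proof cases
        case 3
        then have "bc_density (I - {m}) t a b c d z = 0"
          using pair assms(1) z0 by (intro bc_density_eq_0_pair[of _ k j]) auto
        then show ?thesis by simp
      qed (use zero[of k j] zero[of j k] pair in \<open>auto simp: mult.commute\<close>)
    qed
    have "bc_density I t a b c d z = 0"
      using pair assms(1) z0 by (intro bc_density_eq_0_pair[of _ k j]) auto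
    then show ?thesis by (simp only: mult_zero_right T sum.neutral_const cong: sum.cong)
  next
    case generic
    have nz: "half_kernel t x (z j) \<noteq> 0" if "k \<in> I" "j \<in> I" "j \<noteq> k" "x = z k \<or> x = inverse (z k)" for x k j
    proof -
      have x: "x \<noteq> 0" "norm x = 1" using that z0 circle by (auto simp: norm_inverse)
      have "z k \<noteq> z j" using generic that by (auto simp: inj_on_def)
      moreover have "z k * z j \<noteq> 1" using generic that by auto
      ultimately have "x * z j \<noteq> 1" "x * inverse (z j) \<noteq> 1"
        using that(4) z0[OF that(1)] z0[OF that(2)]
        by (elim disjE; hypsubst; simp add: field_simps)+
      moreover have "norm (t * x * z j) < 1" "norm (t * x * inverse (z j)) < 1"
        using x circle[OF that(2)] t by (auto simp: norm_mult norm_inverse)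
      ultimately show ?thesis
        unfolding half_kernel_def using one_minus_nonzero by (auto simp del: mult_eq_0_iff simp: no_zero_divisors)
    qed
    have T: "?T k = bc_density I t a b c d z *
      ((\<Prod>j\<in>I-{k}. inverse (half_kernel t (z k) (z j))) + (\<Prod>j\<in>I-{k}. inverse (half_kernel t (inverse (z k)) (z j))))"
      if k: "k \<in> I" for k
    proof -
      let ?p = "\<Prod>j\<in>I-{k}. half_kernel t (z k) (z j)" and ?q = "\<Prod>j\<in>I-{k}. half_kernel t (inverse (z k)) (z j)"
      have "?p \<noteq> 0" "?q \<noteq> 0" using nz[OF k] assms(1) by (auto simp: prod_zero_iff)
      moreover have "(\<Prod>j\<in>I-{k}. inverse (half_kernel t (z k) (z j))) = inverse ?p"
        "(\<Prod>j\<in>I-{k}. inverse (half_kernel t (inverse (z k)) (z j))) = inverse ?q"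
        by (simp_all only: prod_inversef[symmetric] o_def)
      ultimately show ?thesis
        unfolding bc_density_remove[OF assms(1) k] prod.distrib by (simp add: field_simps)
    qed
    have S: "(\<Sum>k\<in>I. ?T k) = bc_density I t a b c d z * (\<Sum>k\<in>I.
      ((\<Prod>j\<in>I-{k}. inverse (half_kernel t (z k) (z j))) + (\<Prod>j\<in>I-{k}. inverse (half_kernel t (inverse (z k)) (z j)))))"
      unfolding sum_distrib_left by (rule sum.cong[OF refl T])
    have "(1 - t) * (\<Sum>k\<in>I. ((\<Prod>j\<in>I-{k}. inverse (half_kernel t (z k) (z j)))
        + (\<Prod>j\<in>I-{k}. inverse (half_kernel t (inverse (z k)) (z j)))))
      = (1 + t ^ (card I - 1)) * (1 - t ^ card I)"
      by (rule sum_inverse_half_kernels) (use assms generic in auto)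
    then show ?thesis
      unfolding S by (simp only: mult.left_commute[of "1 - t"] mult.commute[of _ "bc_density I t a b c d z"])
  qed
qed

section \<open>The product formula as a function of the parameters\<close>

text \<open>
With the Vandermonde product as common denominator, identities between sums over four nodes become
polynomial identities without side conditions.
\<close>

lemma sum_of_four_over_vandermonde:
  fixes a b c d :: "'a::field"
  assumes "distinct [a, b, c, d]"
  shows "p / ((a - b) * (a - c) * (a - d)) + q / ((b - a) * (b - c) * (b - d))
       + r / ((c - a) * (c - b) * (c - d)) + s / ((d - a) * (d - b) * (d - c))
     = (p * ((b - c) * (b - d) * (c - d)) - q * ((a - c) * (a - d) * (c - d))
        + r * ((a - b) * (a - d) * (b - d)) - s * ((a - b) * (a - c) * (b - c)))
       / ((a - b) * (a - c) * (a - d) * (b - c) * (b - d) * (c - d))"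
proof -
  have ne: "a - b \<noteq> 0" "a - c \<noteq> 0" "a - d \<noteq> 0" "b - c \<noteq> 0" "b - d \<noteq> 0" "c - d \<noteq> 0"
    using assms by auto
  let ?V = "(a - b) * (a - c) * (a - d) * (b - c) * (b - d) * (c - d)"
  have "p / ((a - b) * (a - c) * (a - d)) = p * ((b - c) * (b - d) * (c - d)) / ?V"
    using ne by (simp add: divide_simps)
  moreover have "q / ((b - a) * (b - c) * (b - d)) = - (q * ((a - c) * (a - d) * (c - d))) / ?V"
    using ne by (simp add: frac_eq_eq minus_diff_eq[of a b, symmetric] del: minus_diff_eq)
  moreover have "r / ((c - a) * (c - b) * (c - d)) = r * ((a - b) * (a - d) * (b - d)) / ?V"
    using ne by (simp add: frac_eq_eq minus_diff_eq[of a c, symmetric] minus_diff_eq[of b c, symmetric] del: minus_diff_eq)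
  moreover have "s / ((d - a) * (d - b) * (d - c)) = - (s * ((a - b) * (a - c) * (b - c))) / ?V"
    using ne by (simp add: frac_eq_eq minus_diff_eq[of a d, symmetric] minus_diff_eq[of b d, symmetric]
       minus_diff_eq[of c d, symmetric] del: minus_diff_eq)
  ultimately show ?thesis
    by (simp add: add_divide_distrib diff_divide_distrib)
qed

lemma partial_fractions_four:
  fixes a b c d z :: "'a::field"
  assumes "distinct [a, b, c, d]" "z \<notin> {a, b, c, d}"
  shows "1 / ((z - a) * (z - b) * (z - c) * (z - d)) =
     1 / (z - a) / ((a - b) * (a - c) * (a - d)) + 1 / (z - b) / ((b - a) * (b - c) * (b - d))
   + 1 / (z - c) / ((c - a) * (c - b) * (c - d)) + 1 / (z - d) / ((d - a) * (d - b) * (d - c))"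
proof -
  have ne: "a - b \<noteq> 0" "a - c \<noteq> 0" "a - d \<noteq> 0" "b - c \<noteq> 0" "b - d \<noteq> 0" "c - d \<noteq> 0"
    "z - a \<noteq> 0" "z - b \<noteq> 0" "z - c \<noteq> 0" "z - d \<noteq> 0"
    using assms by auto
  have num: "(a - b) * (a - c) * (a - d) * (b - c) * (b - d) * (c - d) =
      (((b - c) * (b - d) * (c - d) * (z - b) - (a - c) * (a - d) * (c - d) * (z - a)) * (z - c) +
       (a - b) * (a - d) * (b - d) * ((z - a) * (z - b))) * (z - d) -
      (a - b) * (a - c) * (b - c) * ((z - a) * (z - b) * (z - c))"
    by algebra
  have "1 / ((z - a) * (z - b) * (z - c) * (z - d)) * ((a - b) * (a - c) * (a - d) * (b - c) * (b - d) * (c - d))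
    = 1 / (z - a) * ((b - c) * (b - d) * (c - d)) - 1 / (z - b) * ((a - c) * (a - d) * (c - d))
        + 1 / (z - c) * ((a - b) * (a - d) * (b - d)) - 1 / (z - d) * ((a - b) * (a - c) * (b - c))"
    using ne(7-10) num by (simp add: divide_simps)
  then show ?thesis
    unfolding sum_of_four_over_vandermonde[OF assms(1)]
    using ne by (simp add: nonzero_eq_divide_eq)
qed

text \<open>
This is the content of the recursion for the product formula. The three factors with \<open>s\<close>, a power of \<open>t\<close>,
are the last factors of those \<open>q\<close>-shifted factorials in the denominator that do not involve the
parameter in front; they are missing from the formula for one variable less.
\<close>

lemma four_parameter_sum:
  fixes a b c d s :: "'a::field"
  assumes "distinct [a, b, c, d]"
  shows "a * (a^2 - 1) * ((1 - s*b*c) * (1 - s*b*d) * (1 - s*c*d)) / ((a - b) * (a - c) * (a - d))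
       + b * (b^2 - 1) * ((1 - s*a*c) * (1 - s*a*d) * (1 - s*c*d)) / ((b - a) * (b - c) * (b - d))
       + c * (c^2 - 1) * ((1 - s*b*a) * (1 - s*b*d) * (1 - s*a*d)) / ((c - a) * (c - b) * (c - d))
       + d * (d^2 - 1) * ((1 - s*b*c) * (1 - s*b*a) * (1 - s*c*a)) / ((d - a) * (d - b) * (d - c))
     = (1 + s) * (1 - s^2 * a*b*c*d)"
proof -
  have "(a - b) * (a - c) * (a - d) * (b - c) * (b - d) * (c - d) \<noteq> 0"
    using assms by auto
  moreover have "a * (a^2 - 1) * ((1 - s*b*c) * (1 - s*b*d) * (1 - s*c*d)) * ((b - c) * (b - d) * (c - d))
       - b * (b^2 - 1) * ((1 - s*a*c) * (1 - s*a*d) * (1 - s*c*d)) * ((a - c) * (a - d) * (c - d))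
       + c * (c^2 - 1) * ((1 - s*b*a) * (1 - s*b*d) * (1 - s*a*d)) * ((a - b) * (a - d) * (b - d))
       - d * (d^2 - 1) * ((1 - s*b*c) * (1 - s*b*a) * (1 - s*c*a)) * ((a - b) * (a - c) * (b - c))
     = (1 + s) * (1 - s^2 * a*b*c*d) * ((a - b) * (a - c) * (a - d) * (b - c) * (b - d) * (c - d))"
    by algebra
  ultimately show ?thesis
    unfolding sum_of_four_over_vandermonde[OF assms] by (simp add: nonzero_divide_eq_eq)
qed

text \<open>
The finite \<open>q\<close>-shifted factorial \<open>(x; t)\<^sub>n\<close>, with base \<open>t\<close> as first argument.
\<close>

definition q_pochhammer :: "complex \<Rightarrow> complex \<Rightarrow> nat \<Rightarrow> complex" where
  "q_pochhammer t x n = (\<Prod>i<n. 1 - t ^ i * x)"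

lemma q_pochhammer_Suc: "q_pochhammer t x (Suc n) = (1 - t ^ n * x) * q_pochhammer t x n"
  by (simp add: q_pochhammer_def)

lemma q_pochhammer_Suc_shift: "q_pochhammer t x (Suc n) = (1 - x) * q_pochhammer t (t * x) n"
  unfolding q_pochhammer_def by (subst prod.lessThan_Suc_shift) (simp add: mult_ac)

lemma norm_power_mult_less_1:
  assumes "norm t \<le> 1" "norm (x::complex) < 1"
  shows "norm (t ^ i * x) < 1"
proof -
  have "norm (t ^ i) \<le> 1" using assms by (simp add: norm_power power_le_one)
  then show ?thesis using assms mult_left_le_one_le[of "norm x" "norm (t ^ i)"] by (simp add: norm_mult)
qed

lemma q_pochhammer_nonzero:
  assumes "norm t < 1" "norm x < 1"
  shows "q_pochhammer t x n \<noteq> 0"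
  unfolding q_pochhammer_def prod_zero_iff[OF finite_lessThan]
  using one_minus_nonzero[OF norm_power_mult_less_1[of t x]] assms by auto

lemma norm_mult_less_1: "norm (x * y) < 1" if "norm (x::complex) < 1" "norm y < 1"
  using norm_power_mult_less_1[of x y 1] that by simp

text \<open>
The product formula, with the numerator exponents \<open>n - 1, \<dots>, 2 n - 2\<close> listed upwards. For \<open>n = 0\<close> the
truncated exponent \<open>n - 1\<close> is harmless, since the \<open>q\<close>-shifted factorial is then empty.
\<close>

definition gustafson_value ::
    "nat \<Rightarrow> complex \<Rightarrow> complex \<Rightarrow> complex \<Rightarrow> complex \<Rightarrow> complex \<Rightarrow> complex" where
  "gustafson_value n t a b c d =
     q_pochhammer t (t ^ (n - 1) * (a*b*c*d)) n /
     (q_pochhammer t (a*b) n * q_pochhammer t (a*c) n * q_pochhammer t (a*d) n *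
      q_pochhammer t (b*c) n * q_pochhammer t (b*d) n * q_pochhammer t (c*d) n) * (\<Prod>j\<in>{1..n}. (1 - t) / (1 - t ^ j))"

lemma gustafson_value_swap:
  "gustafson_value n t a b c d = gustafson_value n t b a c d"
  "gustafson_value n t a b c d = gustafson_value n t c b a d"
  "gustafson_value n t a b c d = gustafson_value n t d b c a"
  by (simp_all add: gustafson_value_def mult_ac)

text \<open>
The residue at \<open>x = a\<close> of the one-variable weight with respect to \<open>dx / x\<close>. It is \<open>0\<close> at \<open>a = 0\<close>, in
accordance with the absence of a pole there.
\<close>

definition site_residue :: "complex \<Rightarrow> complex \<Rightarrow> complex \<Rightarrow> complex \<Rightarrow> complex" where
  "site_residue a b c d =
     a * (a^2 - 1) / ((1 - a*b) * (1 - a*c) * (1 - a*d)) / ((a - b) * (a - c) * (a - d))"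

text \<open>
Replacing \<open>a\<close> by \<open>t a\<close> shifts each of \<open>(a b; t)\<^sub>n\<close>, \<open>(a c; t)\<^sub>n\<close>, \<open>(a d; t)\<^sub>n\<close> by one step, so it completes
them to length \<open>n + 1\<close> up to the first factor, which the residue supplies; the three factorials without
\<open>a\<close> lack their last factor instead. The starting exponent of the numerator rises from \<open>n - 1\<close> to \<open>n\<close>.
\<close>

lemma gustafson_value_shift:
  assumes "norm t < 1" "norm a < 1" "norm b < 1" "norm c < 1" "norm d < 1"
  shows "(1 - t) * (1 - (t^n)^2 * a*b*c*d) * (site_residue a b c d * gustafson_value n t (t * a) b c d)
    = (1 - t ^ Suc n) * gustafson_value (Suc n) t a b c d *
      (a * (a^2 - 1) * ((1 - t^n*b*c) * (1 - t^n*b*d) * (1 - t^n*c*d)) / ((a - b) * (a - c) * (a - d)))"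
proof -
  have t: "norm t \<le> 1" using assms by simp
  have "norm (t ^ Suc n) < 1"
    unfolding power_Suc2 by (intro norm_power_mult_less_1 t assms)
  moreover have "norm ((t^n)^2 * (a*b*c*d)) < 1"
    unfolding power_mult[symmetric] by (intro norm_power_mult_less_1 norm_mult_less_1 t assms)
  ultimately have nz: "1 - a*b \<noteq> 0" "1 - a*c \<noteq> 0" "1 - a*d \<noteq> 0" "1 - t \<noteq> 0" "1 - t ^ Suc n \<noteq> 0"
    "1 - t^n*(b*c) \<noteq> 0" "1 - t^n*(b*d) \<noteq> 0" "1 - t^n*(c*d) \<noteq> 0"
    "1 - (t^n)^2 * (a*b*c*d) \<noteq> 0"
    using norm_power_mult_less_1[OF t, of _ n] norm_mult_less_1 assms one_minus_nonzero by metis+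
  define A where "A = q_pochhammer t (t*(a*b)) n * q_pochhammer t (t*(a*c)) n * q_pochhammer t (t*(a*d)) n *
     q_pochhammer t (b*c) n * q_pochhammer t (b*d) n * q_pochhammer t (c*d) n"
  define Q where "Q = q_pochhammer t (t ^ n * (a*b*c*d)) n"
  define R where "R = (\<Prod>j\<in>{1..n}. (1 - t) / (1 - t ^ j))"
  have "q_pochhammer t (t ^ (n - 1) * (t*a*b*c*d)) n = Q"
    unfolding Q_def by (cases n) (simp_all add: q_pochhammer_def mult_ac)
  then have 1: "gustafson_value n t (t * a) b c d = Q / A * R"
    unfolding gustafson_value_def A_def R_def by (simp add: mult.assoc)
  have 2: "gustafson_value (Suc n) t a b c d =
     (1 - (t^n)^2 * (a*b*c*d)) * Q /
      ((1 - a*b) * (1 - a*c) * (1 - a*d) * ((1 - t^n*(b*c)) * (1 - t^n*(b*d)) * (1 - t^n*(c*d))) * A)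
      * (R * ((1 - t) / (1 - t ^ Suc n)))"
    unfolding gustafson_value_def A_def R_def Q_def q_pochhammer_Suc_shift[of t "a * _"]
      q_pochhammer_Suc[of t "_ * (a*b*c*d)"] q_pochhammer_Suc[of t "b * _"] q_pochhammer_Suc[of t "c * _"]
    by (simp add: mult_ac power2_eq_square)
  show ?thesis
    unfolding 1 2 site_residue_def using nz by (simp add: mult_ac)
qed

lemma sum_site_residues_gustafson:
  assumes "norm t < 1" "norm a < 1" "norm b < 1" "norm c < 1" "norm d < 1" "distinct [a, b, c, d]"
  shows "(1 - t) * (site_residue a b c d * gustafson_value n t (t * a) b c d
      + site_residue b a c d * gustafson_value n t (t * b) a c d
      + site_residue c b a d * gustafson_value n t (t * c) b a d
      + site_residue d b c a * gustafson_value n t (t * d) b c a)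
    = (1 + t ^ n) * (1 - t ^ Suc n) * gustafson_value (Suc n) t a b c d"
    (is "(1 - t) * (?A + ?B + ?C + ?D) = _")
proof -
  let ?G = "gustafson_value (Suc n) t a b c d" and ?e = "1 - (t^n)^2 * a*b*c*d" and ?s = "t ^ n"
  have e: "?e * ((1 - t) * (?A + ?B + ?C + ?D)) = (1 - t ^ Suc n) * ?G * (
      a * (a^2 - 1) * ((1 - ?s*b*c) * (1 - ?s*b*d) * (1 - ?s*c*d)) / ((a - b) * (a - c) * (a - d))
    + b * (b^2 - 1) * ((1 - ?s*a*c) * (1 - ?s*a*d) * (1 - ?s*c*d)) / ((b - a) * (b - c) * (b - d))
    + c * (c^2 - 1) * ((1 - ?s*b*a) * (1 - ?s*b*d) * (1 - ?s*a*d)) / ((c - a) * (c - b) * (c - d))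
    + d * (d^2 - 1) * ((1 - ?s*b*c) * (1 - ?s*b*a) * (1 - ?s*c*a)) / ((d - a) * (d - b) * (d - c)))"
    using gustafson_value_shift[OF assms(1-5), of n] gustafson_value_shift[OF assms(1,3,2,4,5), of n]
      gustafson_value_shift[OF assms(1,4,3,2,5), of n] gustafson_value_shift[OF assms(1,5,3,4,2), of n]
    unfolding gustafson_value_swap(1)[of "Suc n" t b] gustafson_value_swap(2)[of "Suc n" t c]
      gustafson_value_swap(3)[of "Suc n" t d]
    by (simp only: distrib_left mult_ac)
  have "norm (?s * (?s * (a * (b * (c * d))))) < 1"
    using assms by (intro norm_power_mult_less_1 norm_mult_less_1) auto
  then have "?e \<noteq> 0" using one_minus_nonzero by (metis mult.assoc power2_eq_square)
  then show ?thesis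
    using e unfolding four_parameter_sum[OF assms(6)] by (simp add: mult_ac)
qed

section \<open>Integration over the circle\<close>

lemma finite_measure_circle_measure: "finite_measure circle_measure"
  by (rule finite_measureI) (simp add: space_circle_measure emeasure_circle_measure)

lemma product_sigma_finite_circle_measure: "product_sigma_finite (\<lambda>_. circle_measure)"
  using finite_measure_circle_measure
  by (simp add: product_sigma_finite_def finite_measure_def)

text \<open>
Finiteness turns bounded measurable functions into integrable ones, which settles all integrability
questions below.
\<close>

lemma finite_measure_torus:
  assumes "finite I"
  shows "finite_measure (\<Pi>\<^sub>M j\<in>I. circle_measure)"
proof (rule finite_measureI)
  have "emeasure circle_measure (space circle_measure) = 1"
    by (simp add: space_circle_measure emeasure_circle_measure)
  then show "emeasure (\<Pi>\<^sub>M j\<in>I. circle_measure) (space (\<Pi>\<^sub>M j\<in>I. circle_measure)) \<noteq> \<infinity>"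
    unfolding space_PiM
    by (simp add: product_sigma_finite.emeasure_PiM[OF product_sigma_finite_circle_measure assms])
qed

lemma measurable_circle_measure:
  assumes "f \<in> borel_measurable borel"
  shows "f \<in> borel_measurable circle_measure"
proof -
  have "sets circle_measure = sets (restrict_space borel (sphere 0 1))"
    by (simp add: circle_measure_def)
  moreover have "f \<in> borel_measurable (restrict_space borel (sphere 0 1))"
    by (rule measurable_restrict_space1[OF assms])
  ultimately show ?thesis by (simp cong: measurable_cong_sets)
qed

lemma measurable_torus_component:
  assumes "i \<in> I"
  shows "(\<lambda>z. z i) \<in> borel_measurable (\<Pi>\<^sub>M j\<in>I. circle_measure)"
  using measurable_compose[OF measurable_component_singleton[OF assms] measurable_circle_measure[of "\<lambda>x. x"]]
  by simp

lemma circle_integral_eq_interval: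
  fixes f :: "complex \<Rightarrow> complex"
  assumes f: "f \<in> borel_measurable borel"
  shows "(LINT x|circle_measure. f x) = (LINT \<theta>:{0..1}|lborel. f (cis (2 * pi * \<theta>)))"
proof -
  have "(LINT x|circle_measure. f x) = (LINT \<theta>|restrict_space lborel {0..1}. f (cis (2 * pi * \<theta>)))"
    unfolding circle_measure_def
    by (rule integral_distr[OF measurable_cis_circle measurable_restrict_space1[OF f]])
  also have "\<dots> = (LINT \<theta>:{0..1}|lborel. f (cis (2 * pi * \<theta>)))"
    unfolding set_lebesgue_integral_def by (rule integral_restrict_space) auto
  finally show ?thesis .
qed

text \<open>
Inversion of the circle is the reflection \<open>\<theta> \<mapsto> 1 - \<theta>\<close> of the unit interval.
\<close>

lemma circle_integral_inverse:
  fixes f :: "complex \<Rightarrow> complex"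
  assumes f [measurable]: "f \<in> borel_measurable borel"
  shows "(LINT x|circle_measure. f (inverse x)) = (LINT x|circle_measure. f x)"
proof -
  have "(LINT x|circle_measure. f x) = (LINT \<theta>|lborel. indicator {0..1} \<theta> *\<^sub>R f (cis (2 * pi * \<theta>)))"
    by (simp add: circle_integral_eq_interval[OF f] set_lebesgue_integral_def)
  also have "\<dots> = (LINT \<theta>|lborel. indicator {0..1} (1 + -1 * \<theta>) *\<^sub>R f (cis (2 * pi * (1 + -1 * \<theta>))))"
    by (subst lborel_integral_real_affine[where c = "-1" and t = 1]) simp_all
  also have "\<dots> = (LINT \<theta>|lborel. indicator {0..1} \<theta> *\<^sub>R f (inverse (cis (2 * pi * \<theta>))))"
  proof (rule Bochner_Integration.integral_cong[OF refl])
    fix \<theta> :: real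
    have "cis (2 * pi * (1 + -1 * \<theta>)) = cis (2 * pi) * cis (- (2 * pi * \<theta>))"
      by (simp add: cis_mult algebra_simps)
    then show "indicator {0..1} (1 + -1 * \<theta>) *\<^sub>R f (cis (2 * pi * (1 + -1 * \<theta>)))
      = (indicator {0..1} \<theta> *\<^sub>R f (inverse (cis (2 * pi * \<theta>))) :: complex)"
      by (cases "\<theta> \<in> {0..1}") (auto simp: indicator_def)
  qed
  also have "\<dots> = (LINT x|circle_measure. f (inverse x))"
    unfolding set_lebesgue_integral_def[symmetric]
    by (rule circle_integral_eq_interval[of "\<lambda>x. f (inverse x)", symmetric]) measurable
  finally show ?thesis ..
qed

lemma half_kernel_denominator_nonzero:
  fixes t x y :: complex
  assumes "norm t < 1" "norm x \<le> 1" "norm y = 1"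
  shows "1 - t * x * y \<noteq> 0" "1 - t * x * inverse y \<noteq> 0"
proof -
  have "norm (t * x) < 1"
    using assms(1) mult_left_le[OF assms(2) norm_ge_zero[of t]] unfolding norm_mult by linarith
  then have "norm (t * x * y) < 1" "norm (t * x * inverse y) < 1"
    using assms by (simp_all add: norm_mult norm_inverse)
  then show "1 - t * x * y \<noteq> 0" "1 - t * x * inverse y \<noteq> 0"
    by (auto simp only: one_minus_nonzero)
qed

text \<open>
On the circle, \<open>1 / x\<close> times the integrand is \<open>g(x) / ((x - a) (x - b) (x - c) (x - d))\<close> with \<open>g\<close>
holomorphic on the closed disc; the negative powers of \<open>x\<close> in the numerator are absorbed by the four
factors \<open>1 - a / x\<close>, and so on, which leaves no pole at \<open>0\<close>. Partial fractions and
Cauchy's formula evaluate the integral.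
\<close>

lemma circle_integral_by_residues:
  fixes z :: "'i \<Rightarrow> complex"
  assumes t: "norm t < 1" and z: "\<And>j. j \<in> J \<Longrightarrow> norm (z j) = 1"
    and n: "norm a < 1" "norm b < 1" "norm c < 1" "norm d < 1" and dist: "distinct [a, b, c, d]"
  shows "(LINT x|circle_measure. site_weight a b c d x * (\<Prod>j\<in>J. half_kernel t x (z j))) =
      site_residue a b c d * (\<Prod>j\<in>J. half_kernel t a (z j))
    + site_residue b a c d * (\<Prod>j\<in>J. half_kernel t b (z j))
    + site_residue c b a d * (\<Prod>j\<in>J. half_kernel t c (z j))
    + site_residue d b c a * (\<Prod>j\<in>J. half_kernel t d (z j))" (is "_ = ?R")
proof -
  define H where "H x = (\<Prod>j\<in>J. half_kernel t x (z j))" for x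
  define g where "g x = (1 - x^2) * (x^2 - 1) * x * H x / ((1 - a*x) * (1 - b*x) * (1 - c*x) * (1 - d*x))" for x
  have den: "1 - p * x \<noteq> 0" if "norm p < 1" "norm x \<le> 1" for p x :: complex
    using half_kernel_denominator_nonzero(1)[OF that, of 1] by simp
  have H_hol: "H holomorphic_on cball 0 1"
    unfolding H_def half_kernel_def
    using half_kernel_denominator_nonzero[OF t _ z]
    by (intro holomorphic_intros) auto
  have g_hol: "g holomorphic_on cball 0 1"
    unfolding g_def using den n by (intro holomorphic_intros H_hol) auto
  have g_contour: "((\<lambda>u. g u / (u - w)) has_contour_integral (2 * of_real pi * \<i> * g w)) (circlepath 0 1)"
    if "norm w < 1" for w
    using that g_hol
    by (intro Cauchy_integral_circlepath holomorphic_on_imp_continuous_on)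
       (auto intro: holomorphic_on_subset)
  define A where "A = 1 / ((a - b) * (a - c) * (a - d))"
  define B where "B = 1 / ((b - a) * (b - c) * (b - d))"
  define C where "C = 1 / ((c - a) * (c - b) * (c - d))"
  define D where "D = 1 / ((d - a) * (d - b) * (d - c))"
  let ?f = "\<lambda>x. site_weight a b c d x * H x"
  have on_circle: "1 / (2 * of_real pi * \<i>) * (A * (g x / (x - a)) + B * (g x / (x - b)) + C * (g x / (x - c)) + D * (g x / (x - d)))
      = ?f x / (2 * of_real pi * \<i> * x)" if "norm x = 1" for x
  proof -
    have x: "x \<noteq> 0" "x \<notin> {a, b, c, d}" using that n by auto
    have flip: "1 - p * inverse x = (x - p) / x" for p using x by (simp add: field_simps)
    have sq: "1 - inverse x ^ 2 = (x^2 - 1) / x^2" using x by (simp add: field_simps)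
    have "A * (g x / (x - a)) + B * (g x / (x - b)) + C * (g x / (x - c)) + D * (g x / (x - d))
      = g x * (1 / (x - a) / ((a - b) * (a - c) * (a - d)) + 1 / (x - b) / ((b - a) * (b - c) * (b - d))
       + 1 / (x - c) / ((c - a) * (c - b) * (c - d)) + 1 / (x - d) / ((d - a) * (d - b) * (d - c)))"
      by (simp add: A_def B_def C_def D_def distrib_left mult_ac)
    also have "\<dots> = g x * (1 / ((x - a) * (x - b) * (x - c) * (x - d)))"
      using partial_fractions_four[OF dist x(2)] by simp
    also have "\<dots> = ?f x / x"
      unfolding g_def site_weight_def flip sq
      using x by (simp add: power2_eq_square, simp only: mult_ac)
    finally show ?thesis by simp
  qed
  have "((\<lambda>x. A * (g x / (x - a)) + B * (g x / (x - b)) + C * (g x / (x - c)) + D * (g x / (x - d)))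
      has_contour_integral
        A * (2 * of_real pi * \<i> * g a) + B * (2 * of_real pi * \<i> * g b)
        + C * (2 * of_real pi * \<i> * g c) + D * (2 * of_real pi * \<i> * g d)) (circlepath 0 1)"
    by (intro has_contour_integral_add has_contour_integral_lmul g_contour n)
  from has_contour_integral_lmul[OF this, of "1 / (2 * of_real pi * \<i>)"]
  have "((\<lambda>x. ?f x / (2 * of_real pi * \<i> * x)) has_contour_integral
      1 / (2 * of_real pi * \<i>) * (A * (2 * of_real pi * \<i> * g a) + B * (2 * of_real pi * \<i> * g b)
        + C * (2 * of_real pi * \<i> * g c) + D * (2 * of_real pi * \<i> * g d))) (circlepath 0 1)"
    by (rule has_contour_integral_eq) (rule on_circle, simp)
  moreover have "1 / w * (A * (w * g a) + B * (w * g b) + C * (w * g c) + D * (w * g d))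
      = A * g a + B * g b + C * g c + D * g d" if "w \<noteq> 0" for w
    using that by (simp add: field_simps)
  ultimately have "contour_integral (circlepath 0 1) (\<lambda>x. ?f x / (2 * of_real pi * \<i> * x))
      = A * g a + B * g b + C * g c + D * g d"
    by (simp only: contour_integral_unique) simp
  moreover have "continuous_on (sphere 0 1) ?f"
  proof (intro continuous_on_mult)
    show "continuous_on (sphere 0 1) H"
      using H_hol by (rule continuous_on_subset[OF holomorphic_on_imp_continuous_on]) auto
    have den': "1 - p * inverse x \<noteq> 0" if "norm p < 1" "norm x = 1" for p x :: complex
      using den[OF that(1), of "inverse x"] that by (simp add: norm_inverse)
    show "continuous_on (sphere 0 1) (site_weight a b c d)"
      unfolding site_weight_def using den n den' by (intro continuous_intros) auto
  qed
  moreover have "A * g a = site_residue a b c d * H a" "B * g b = site_residue b a c d * H b"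
    "C * g c = site_residue c b a d * H c" "D * g d = site_residue d b c a * H d"
    using den[OF n(1), of a] den[OF n(2), of b] den[OF n(3), of c] den[OF n(4), of d] n
    by (simp_all add: g_def A_def B_def C_def D_def site_residue_def power2_eq_square mult_ac)
  ultimately show ?thesis
    by (simp add: integral_circle_measure H_def)
qed

section \<open>Bounds, integrability and continuity in the parameters\<close>

lemma norm_prod_le_power:
  fixes f :: "'i \<Rightarrow> complex"
  assumes "\<And>i. i \<in> A \<Longrightarrow> norm (f i) \<le> B"
  shows "norm (\<Prod>i\<in>A. f i) \<le> B ^ card A"
proof -
  have "norm (\<Prod>i\<in>A. f i) = (\<Prod>i\<in>A. norm (f i))" by (simp add: prod_norm)
  also have "\<dots> \<le> (\<Prod>i\<in>A. B)" by (rule prod_mono) (use assms in auto)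
  finally show ?thesis by simp
qed

lemma norm_mult_le:
  fixes x y :: complex
  assumes "norm x \<le> K" "norm y \<le> L"
  shows "norm (x * y) \<le> K * L"
  unfolding norm_mult using assms order_trans[OF norm_ge_zero assms(1)] by (intro mult_mono) auto

lemma norm_inverse_one_minus_le:
  fixes x :: complex
  assumes "norm x \<le> r" "r < 1"
  shows "norm (inverse (1 - x)) \<le> inverse (1 - r)"
proof -
  have "1 - r \<le> norm (1 - x)" using norm_triangle_ineq2[of 1 x] assms by simp
  then show ?thesis using assms by (simp add: norm_inverse le_imp_inverse_le)
qed

lemma norm_one_minus_le_2: "norm (x::complex) = 1 \<Longrightarrow> norm (1 - x) \<le> 2"
  using norm_triangle_ineq4[of 1 x] by simp

lemma norm_site_weight_le:
  assumes "norm a \<le> r" "norm b \<le> r" "norm c \<le> r" "norm d \<le> r" "r < 1" "norm x = 1"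
  shows "norm (site_weight a b c d x) \<le> 4 * inverse (1 - r) ^ 8"
proof -
  have f: "norm (inverse (1 - p * y)) \<le> inverse (1 - r)" if "norm p \<le> r" "norm y = 1" for p y :: complex
    using that assms(5) by (intro norm_inverse_one_minus_le) (auto simp: norm_mult)
  have i: "norm (inverse x) = 1" using assms by (simp add: norm_inverse)
  let ?f = "\<lambda>p. inverse (1 - p * x) * inverse (1 - p * inverse x)"
  have "norm (((1 - x^2) * (1 - inverse x ^ 2)) * (?f a * ?f b * ?f c * ?f d))
      \<le> (2 * 2) * ((inverse (1 - r) * inverse (1 - r)) * (inverse (1 - r) * inverse (1 - r))
        * (inverse (1 - r) * inverse (1 - r)) * (inverse (1 - r) * inverse (1 - r)))"
    by (intro norm_mult_le norm_one_minus_le_2 f assms i) (simp_all add: norm_power i assms(6))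
  moreover have "site_weight a b c d x = ((1 - x^2) * (1 - inverse x ^ 2)) * (?f a * ?f b * ?f c * ?f d)"
    by (simp add: site_weight_def divide_inverse mult_ac)
  ultimately show ?thesis by (simp add: eval_nat_numeral mult_ac)
qed

lemma norm_half_kernel_le:
  assumes "norm t \<le> r" "r < 1" "norm x = 1" "norm y = 1"
  shows "norm (half_kernel t x y) \<le> 4 * inverse (1 - r) ^ 2"
proof -
  have "norm (((1 - x * y) * (1 - x * inverse y)) * (inverse (1 - t * x * y) * inverse (1 - t * x * inverse y)))
    \<le> (2 * 2) * (inverse (1 - r) * inverse (1 - r))"
    using assms
    by (intro norm_mult_le norm_one_minus_le_2 norm_inverse_one_minus_le) (simp_all add: norm_mult norm_inverse)
  then show ?thesis by (simp add: half_kernel_def divide_inverse power2_eq_square)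
qed

text \<open>
The bound depends on the parameters only through \<open>r\<close>. It is therefore a dominating constant for any
sequence of parameters in the disc of radius \<open>r\<close>.
\<close>

lemma norm_bc_density_le:
  assumes "norm t \<le> r" "norm a \<le> r" "norm b \<le> r" "norm c \<le> r" "norm d \<le> r" "r < 1"
    and "\<And>i. i \<in> I \<Longrightarrow> norm (z i) = 1"
  shows "norm (bc_density I t a b c d z) \<le> (4 * inverse (1 - r) ^ 8) ^ card I *
     ((4 * inverse (1 - r) ^ 2) * (4 * inverse (1 - r) ^ 2)) ^ card {(i, j). i \<in> I \<and> j \<in> I \<and> i < j}"
proof -
  have "norm (half_kernel t (z i) (z j) * half_kernel t (inverse (z i)) (z j))
      \<le> (4 * inverse (1 - r) ^ 2) * (4 * inverse (1 - r) ^ 2)" if "i \<in> I" "j \<in> I" for i j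
    using assms that by (intro norm_mult_le norm_half_kernel_le) (auto simp: norm_inverse)
  then show ?thesis
    unfolding bc_density_def using assms
    by (intro norm_mult_le norm_prod_le_power norm_site_weight_le) auto
qed

lemma torus_component_norm:
  assumes "z \<in> space (\<Pi>\<^sub>M j\<in>I. circle_measure)" "i \<in> I"
  shows "norm (z i) = 1"
  using assms by (auto simp: space_PiM space_circle_measure PiE_def Pi_def)

lemma measurable_half_kernel:
  assumes [measurable]: "f \<in> borel_measurable M" "g \<in> borel_measurable M"
  shows "(\<lambda>x. half_kernel t (f x) (g x)) \<in> borel_measurable M"
  unfolding half_kernel_def by measurable

lemma measurable_site_weight [measurable]: "site_weight a b c d \<in> borel_measurable borel"
  unfolding site_weight_def by measurable

lemma measurable_bc_density:
  assumes "J \<subseteq> I"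
  shows "bc_density J t a b c d \<in> borel_measurable (\<Pi>\<^sub>M j\<in>I. circle_measure)"
proof -
  have comp [measurable]: "(\<lambda>z. z i) \<in> borel_measurable (\<Pi>\<^sub>M j\<in>I. circle_measure)" if "i \<in> J" for i
    using that assms by (intro measurable_torus_component) auto
  have "(\<lambda>z. \<Prod>i\<in>J. site_weight a b c d (z i)) \<in> borel_measurable (\<Pi>\<^sub>M j\<in>I. circle_measure)"
    by (intro borel_measurable_prod measurable_compose[OF comp measurable_site_weight])
  moreover have "(\<lambda>z. inverse (z i)) \<in> borel_measurable (\<Pi>\<^sub>M j\<in>I. circle_measure)" if "i \<in> J" for i
    by (intro borel_measurable_inverse comp that)
  ultimately show ?thesis
    unfolding bc_density_def split_def
    by (intro borel_measurable_times borel_measurable_prod measurable_half_kernel comp) auto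
qed

lemma bc_density_integral_tendsto:
  assumes "finite I" "r < 1"
    and bound: "\<And>m. norm (t' m) \<le> r" "\<And>m. norm (a' m) \<le> r" "\<And>m. norm (b' m) \<le> r"
      "\<And>m. norm (c' m) \<le> r" "\<And>m. norm (d' m) \<le> r"
    and lim: "t' \<longlonglongrightarrow> t" "a' \<longlonglongrightarrow> a" "b' \<longlonglongrightarrow> b" "c' \<longlonglongrightarrow> c" "d' \<longlonglongrightarrow> d"
  shows "(\<lambda>m. LINT z|(\<Pi>\<^sub>M j\<in>I. circle_measure). bc_density I (t' m) (a' m) (b' m) (c' m) (d' m) z)
    \<longlonglongrightarrow> (LINT z|(\<Pi>\<^sub>M j\<in>I. circle_measure). bc_density I t a b c d z)"
proof (rule integral_dominated_convergence)
  interpret finite_measure "\<Pi>\<^sub>M j\<in>I. circle_measure" by (rule finite_measure_torus[OF assms(1)])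
  let ?B = "(4 * inverse (1 - r) ^ 8) ^ card I *
     ((4 * inverse (1 - r) ^ 2) * (4 * inverse (1 - r) ^ 2)) ^ card {(i, j). i \<in> I \<and> j \<in> I \<and> i < j}"
  show "integrable (\<Pi>\<^sub>M j\<in>I. circle_measure) (\<lambda>_. ?B)" by simp
  show "AE z in \<Pi>\<^sub>M j\<in>I. circle_measure. norm (bc_density I (t' m) (a' m) (b' m) (c' m) (d' m) z) \<le> ?B" for m
    by (intro AE_I2 norm_bc_density_le bound \<open>r < 1\<close> torus_component_norm)
  have le: "norm t \<le> r" "norm a \<le> r" "norm b \<le> r" "norm c \<le> r" "norm d \<le> r"
    using lim bound by (auto intro: LIMSEQ_le_const2[OF tendsto_norm])
  show "AE z in \<Pi>\<^sub>M j\<in>I. circle_measure.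
      (\<lambda>m. bc_density I (t' m) (a' m) (b' m) (c' m) (d' m) z) \<longlonglongrightarrow> bc_density I t a b c d z"
  proof (rule AE_I2)
    fix z assume "z \<in> space (\<Pi>\<^sub>M j\<in>I. circle_measure)"
    then have z: "norm (z i) = 1" "norm (inverse (z i)) = 1" if "i \<in> I" for i
      using torus_component_norm that by (auto simp: norm_inverse)
    have nz: "1 - p * x \<noteq> 0" if "norm p \<le> r" "norm x = 1" for p x :: complex
      using that \<open>r < 1\<close> by (intro one_minus_nonzero) (simp add: norm_mult)
    have "(\<lambda>m. site_weight (a' m) (b' m) (c' m) (d' m) (z i)) \<longlonglongrightarrow> site_weight a b c d (z i)" if "i \<in> I" for i
      unfolding site_weight_def using nz le z[OF that] by (intro tendsto_intros lim) auto
    moreover have "(\<lambda>m. half_kernel (t' m) x (z j)) \<longlonglongrightarrow> half_kernel t x (z j)" if "norm x = 1" "j \<in> I" for x j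
      unfolding half_kernel_def mult.assoc[of _ x] using nz[OF le(1)] z[OF that(2)] that(1)
      by (intro tendsto_intros lim) (auto simp: norm_mult)
    ultimately show "(\<lambda>m. bc_density I (t' m) (a' m) (b' m) (c' m) (d' m) z) \<longlonglongrightarrow> bc_density I t a b c d z"
      unfolding bc_density_def split_def using z by (intro tendsto_mult tendsto_prod) auto
  qed
qed (intro measurable_bc_density order_refl)+

lemma q_pochhammer_tendsto [tendsto_intros]:
  "(t' \<longlongrightarrow> t) F \<Longrightarrow> (x' \<longlongrightarrow> x) F \<Longrightarrow> ((\<lambda>m. q_pochhammer (t' m) (x' m) n) \<longlongrightarrow> q_pochhammer t x n) F"
  unfolding q_pochhammer_def by (intro tendsto_intros)

lemma gustafson_value_tendsto:
  assumes "norm t < 1" "norm a < 1" "norm b < 1" "norm c < 1" "norm d < 1"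
    and lim: "t' \<longlonglongrightarrow> t" "a' \<longlonglongrightarrow> a" "b' \<longlonglongrightarrow> b" "c' \<longlonglongrightarrow> c" "d' \<longlonglongrightarrow> d"
  shows "(\<lambda>m. gustafson_value n (t' m) (a' m) (b' m) (c' m) (d' m)) \<longlonglongrightarrow> gustafson_value n t a b c d"
proof -
  have "1 - t ^ j \<noteq> 0" if "j \<in> {1..n}" for j
  proof -
    have "norm (t ^ j) < 1" using that assms(1) by (simp add: norm_power power_less_one_iff)
    then show ?thesis by (rule one_minus_nonzero)
  qed
  then show ?thesis
    unfolding gustafson_value_def using q_pochhammer_nonzero norm_mult_less_1 assms(1-5)
    by (intro tendsto_intros lim) auto
qed

lemma integrable_bc_density:
  assumes "finite I" "norm t < 1" "norm a < 1" "norm b < 1" "norm c < 1" "norm d < 1"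
  shows "integrable (\<Pi>\<^sub>M j\<in>I. circle_measure) (bc_density I t a b c d)"
proof -
  interpret finite_measure "\<Pi>\<^sub>M j\<in>I. circle_measure" by (rule finite_measure_torus[OF assms(1)])
  define r where "r = Max {norm t, norm a, norm b, norm c, norm d}"
  have "r < 1" "norm t \<le> r" "norm a \<le> r" "norm b \<le> r" "norm c \<le> r" "norm d \<le> r"
    using assms by (auto simp: r_def)
  then show ?thesis
    by (intro integrable_const_bound[OF AE_I2[OF norm_bc_density_le]] measurable_bc_density torus_component_norm) auto
qed

section \<open>Integrating out one variable\<close>

lemma bc_density_cong:
  assumes "\<And>i. i \<in> I \<Longrightarrow> z i = z' i"
  shows "bc_density I t a b c d z = bc_density I t a b c d z'"
  unfolding bc_density_def using assms by (intro arg_cong2[where f = "(*)"] prod.cong) auto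

text \<open>
The numerator of \<open>half_kernel t a x\<close> is the factor of the parameter \<open>a\<close> in the denominator of the
weight, and its denominator is the same factor for \<open>t a\<close>.
\<close>

lemma site_weight_shift:
  assumes "norm a < 1" "norm x = 1"
  shows "site_weight a b c d x * half_kernel t a x = site_weight (t * a) b c d x"
proof -
  have "1 - a * x \<noteq> 0" "1 - a * inverse x \<noteq> 0"
    using half_kernel_denominator_nonzero[of a 1 x] assms by auto
  then show ?thesis
    unfolding site_weight_def half_kernel_def by (simp add: mult_ac)
qed

lemma bc_density_shift:
  assumes "norm a < 1" "\<And>i. i \<in> I \<Longrightarrow> norm (z i) = 1"
  shows "bc_density I t a b c d z * (\<Prod>j\<in>I. half_kernel t a (z j)) = bc_density I t (t * a) b c d z"
proof -
  have "(\<Prod>i\<in>I. site_weight a b c d (z i)) * (\<Prod>j\<in>I. half_kernel t a (z j)) = (\<Prod>i\<in>I. site_weight (t * a) b c d (z i))"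
    unfolding prod.distrib[symmetric] using site_weight_shift assms by (intro prod.cong) auto
  then show ?thesis by (simp add: bc_density_def mult_ac)
qed

text \<open>
The function \<open>e\<close> selects one of the two halves of the symmetrized density. Both halves have the same
integral, since the one-variable weight and the circle measure are invariant under inversion.
\<close>

lemma integrate_out_one_variable:
  assumes I: "finite I" "k \<in> I" and t: "norm t < 1"
    and n: "norm a < 1" "norm b < 1" "norm c < 1" "norm d < 1" and dist: "distinct [a, b, c, d]"
    and e: "e = (\<lambda>x. x) \<or> e = inverse"
  defines "S \<equiv> (\<lambda>a b c d. LINT z|(\<Pi>\<^sub>M j\<in>I-{k}. circle_measure). bc_density (I - {k}) t a b c d z)"
    and "f \<equiv> (\<lambda>z. bc_density (I - {k}) t a b c d z * site_weight a b c d (z k) *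
      (\<Prod>j\<in>I-{k}. half_kernel t (e (z k)) (z j)))"
  shows "integrable (\<Pi>\<^sub>M j\<in>I. circle_measure) f" (is ?int)
    and "(LINT z|(\<Pi>\<^sub>M j\<in>I. circle_measure). f z) =
        site_residue a b c d * S (t * a) b c d + site_residue b a c d * S (t * b) a c d
      + site_residue c b a d * S (t * c) b a d + site_residue d b c a * S (t * d) b c a" (is "?lhs = ?rhs")
proof -
  interpret fin: finite_measure "\<Pi>\<^sub>M j\<in>I. circle_measure" by (rule finite_measure_torus[OF I(1)])
  interpret product_sigma_finite "\<lambda>_. circle_measure" by (rule product_sigma_finite_circle_measure)
  define r where "r = Max {norm t, norm a, norm b, norm c, norm d}"
  have r: "r < 1" "norm t \<le> r" "norm a \<le> r" "norm b \<le> r" "norm c \<le> r" "norm d \<le> r"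
    using t n by (auto simp: r_def)
  have e_norm: "norm (e x) = 1" if "norm x = 1" for x using e that by (auto simp: norm_inverse)
  have meas [measurable]: "f \<in> borel_measurable (\<Pi>\<^sub>M j\<in>I. circle_measure)"
  proof -
    have comp: "(\<lambda>z. z i) \<in> borel_measurable (\<Pi>\<^sub>M j\<in>I. circle_measure)" if "i \<in> I" for i
      by (rule measurable_torus_component[OF that])
    have "(\<lambda>z. e (z k)) \<in> borel_measurable (\<Pi>\<^sub>M j\<in>I. circle_measure)"
      using e comp[OF I(2)] by (auto intro: borel_measurable_inverse)
    then show ?thesis
      unfolding f_def using I(2)
      by (intro borel_measurable_times measurable_bc_density measurable_compose[OF comp measurable_site_weight]
          borel_measurable_prod measurable_half_kernel comp) auto
  qed
  show ?int
  proof (rule fin.integrable_const_bound[OF AE_I2 meas])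
    fix z assume z: "z \<in> space (\<Pi>\<^sub>M j\<in>I. circle_measure)"
    show "norm (f z) \<le> (4 * inverse (1 - r) ^ 8) ^ card (I - {k}) *
     ((4 * inverse (1 - r) ^ 2) * (4 * inverse (1 - r) ^ 2)) ^ card {(i, j). i \<in> I - {k} \<and> j \<in> I - {k} \<and> i < j}
      * (4 * inverse (1 - r) ^ 8) * (4 * inverse (1 - r) ^ 2) ^ card (I - {k})"
      unfolding f_def using torus_component_norm[OF z] I(2)
      by (intro norm_mult_le norm_bc_density_le norm_prod_le_power norm_site_weight_le norm_half_kernel_le r e_norm) auto
  qed
  note int = this
  have inner: "(LINT x|circle_measure. f (y(k := x))) =
      site_residue a b c d * bc_density (I - {k}) t (t * a) b c d y
    + site_residue b a c d * bc_density (I - {k}) t (t * b) a c d y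
    + site_residue c b a d * bc_density (I - {k}) t (t * c) b a d y
    + site_residue d b c a * bc_density (I - {k}) t (t * d) b c a y"
    if y: "y \<in> space (\<Pi>\<^sub>M j\<in>I-{k}. circle_measure)" for y
  proof -
    note ny = torus_component_norm[OF y]
    define g where "g x = site_weight a b c d x * (\<Prod>j\<in>I-{k}. half_kernel t x (y j))" for x
    let ?D = "bc_density (I - {k}) t a b c d y"
    have g_meas: "g \<in> borel_measurable borel"
      unfolding g_def by (intro borel_measurable_times borel_measurable_prod measurable_half_kernel measurable_site_weight) auto
    have "f (y(k := x)) = ?D * g (e x)" for x
    proof -
      have "bc_density (I - {k}) t a b c d (y(k := x)) = ?D" by (rule bc_density_cong) auto
      moreover have "site_weight a b c d (e x) = site_weight a b c d x"
        using e by (auto simp: site_weight_inverse)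
      moreover have "(\<Prod>j\<in>I-{k}. half_kernel t (e x) ((y(k := x)) j)) = (\<Prod>j\<in>I-{k}. half_kernel t (e x) (y j))"
        by (rule prod.cong) auto
      ultimately show ?thesis by (simp add: f_def g_def mult.assoc)
    qed
    then have "(LINT x|circle_measure. f (y(k := x))) = ?D * (LINT x|circle_measure. g (e x))"
      by simp
    also have "(LINT x|circle_measure. g (e x)) = (LINT x|circle_measure. g x)"
      using e circle_integral_inverse[OF g_meas] by auto
    also have "\<dots> = site_residue a b c d * (\<Prod>j\<in>I-{k}. half_kernel t a (y j))
        + site_residue b a c d * (\<Prod>j\<in>I-{k}. half_kernel t b (y j))
        + site_residue c b a d * (\<Prod>j\<in>I-{k}. half_kernel t c (y j))
        + site_residue d b c a * (\<Prod>j\<in>I-{k}. half_kernel t d (y j))"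
      unfolding g_def by (rule circle_integral_by_residues[OF t ny n dist])
    also have "?D * \<dots> = site_residue a b c d * (?D * (\<Prod>j\<in>I-{k}. half_kernel t a (y j)))
        + site_residue b a c d * (?D * (\<Prod>j\<in>I-{k}. half_kernel t b (y j)))
        + site_residue c b a d * (?D * (\<Prod>j\<in>I-{k}. half_kernel t c (y j)))
        + site_residue d b c a * (?D * (\<Prod>j\<in>I-{k}. half_kernel t d (y j)))"
      by (simp only: distrib_left mult.left_commute)
    also have "?D * (\<Prod>j\<in>I-{k}. half_kernel t a (y j)) = bc_density (I - {k}) t (t * a) b c d y"
      by (rule bc_density_shift[OF n(1) ny])
    also have "?D * (\<Prod>j\<in>I-{k}. half_kernel t b (y j)) = bc_density (I - {k}) t (t * b) a c d y"
      unfolding bc_density_swap(1)[of _ _ a b c d] by (rule bc_density_shift[OF n(2) ny])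
    also have "?D * (\<Prod>j\<in>I-{k}. half_kernel t c (y j)) = bc_density (I - {k}) t (t * c) b a d y"
      unfolding bc_density_swap(2)[of _ _ a b c d] by (rule bc_density_shift[OF n(3) ny])
    also have "?D * (\<Prod>j\<in>I-{k}. half_kernel t d (y j)) = bc_density (I - {k}) t (t * d) b c a y"
      unfolding bc_density_swap(3)[of _ _ a b c d] by (rule bc_density_shift[OF n(4) ny])
    finally show ?thesis .
  qed
  have integ: "integrable (\<Pi>\<^sub>M j\<in>I-{k}. circle_measure) (bc_density (I - {k}) t (t * p) b' c' d')"
    if "norm p < 1" "norm b' < 1" "norm c' < 1" "norm d' < 1" for p b' c' d'
    using that t I(1) by (intro integrable_bc_density norm_mult_less_1) auto
  have "insert k (I - {k}) = I" using I(2) by auto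
  then have "?lhs = (LINT y|(\<Pi>\<^sub>M j\<in>I-{k}. circle_measure). LINT x|circle_measure. f (y(k := x)))"
    using product_integral_insert[of "I - {k}" k f] I(1) int by simp
  also have "\<dots> = (LINT y|(\<Pi>\<^sub>M j\<in>I-{k}. circle_measure).
      site_residue a b c d * bc_density (I - {k}) t (t * a) b c d y
    + site_residue b a c d * bc_density (I - {k}) t (t * b) a c d y
    + site_residue c b a d * bc_density (I - {k}) t (t * c) b a d y
    + site_residue d b c a * bc_density (I - {k}) t (t * d) b c a y)"
    by (rule Bochner_Integration.integral_cong[OF refl inner])
  also have "\<dots> = ?rhs"
    unfolding S_def using n by (simp add: integ)
  finally show "?lhs = ?rhs" .
qed

lemma bc_density_integral_recursion:
  assumes I: "finite I" "I \<noteq> {}" and t: "t \<noteq> 0" "norm t < 1"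
    and n: "norm a < 1" "norm b < 1" "norm c < 1" "norm d < 1" and dist: "distinct [a, b, c, d]"
  defines "S \<equiv> (\<lambda>k a b c d. LINT z|(\<Pi>\<^sub>M j\<in>I-{k}. circle_measure). bc_density (I - {k}) t a b c d z)"
  shows "(1 + t ^ (card I - 1)) * (1 - t ^ card I) *
      (LINT z|(\<Pi>\<^sub>M j\<in>I. circle_measure). bc_density I t a b c d z) =
    (1 - t) * (\<Sum>k\<in>I. 2 * (site_residue a b c d * S k (t * a) b c d + site_residue b a c d * S k (t * b) a c d
      + site_residue c b a d * S k (t * c) b a d + site_residue d b c a * S k (t * d) b c a))"
    (is "?C * _ = (1 - t) * (\<Sum>k\<in>I. 2 * ?R k)")
proof -
  define f where "f e k z = bc_density (I - {k}) t a b c d z * site_weight a b c d (z k) *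
      (\<Prod>j\<in>I-{k}. half_kernel t (e (z k)) (z j))" for e k and z :: "nat \<Rightarrow> complex"
  let ?M = "\<Pi>\<^sub>M j\<in>I. circle_measure"
  have int: "integrable ?M (f e k)" and val: "(LINT z|?M. f e k z) = ?R k"
    if "k \<in> I" "e = (\<lambda>x. x) \<or> e = inverse" for e k
    using integrate_out_one_variable[OF I(1) that(1) t(2) n dist that(2)] unfolding f_def S_def by auto
  have "?C * (LINT z|?M. bc_density I t a b c d z) = (LINT z|?M. ?C * bc_density I t a b c d z)"
    by simp
  also have "\<dots> = (LINT z|?M. (1 - t) * (\<Sum>k\<in>I. f (\<lambda>x. x) k z + f inverse k z))"
  proof (rule Bochner_Integration.integral_cong[OF refl])
    fix z assume z: "z \<in> space ?M"
    show "?C * bc_density I t a b c d z = (1 - t) * (\<Sum>k\<in>I. f (\<lambda>x. x) k z + f inverse k z)"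
      using bc_density_symmetrization[OF I t torus_component_norm[OF z], of "\<lambda>k. k" a b c d]
      by (simp add: f_def distrib_left)
  qed
  also have "\<dots> = (1 - t) * (\<Sum>k\<in>I. 2 * ?R k)"
    using int val by (simp add: Bochner_Integration.integral_sum add.assoc)
  finally show ?thesis .
qed

section \<open>The integral for all parameters\<close>

text \<open>
The parameters \<open>a, b, c, d\<close> are moved by distinct multiples of a null sequence, and \<open>t\<close> by a nonzero one. So
any two of \<open>a, b, c, d\<close> coincide, and \<open>t\<close> vanishes, for at most one value of the perturbation.
\<close>

lemma generic_parameters_dense:
  fixes t a b c d :: complex
  assumes "norm t < 1" "norm a < 1" "norm b < 1" "norm c < 1" "norm d < 1"
  obtains T A B C D :: "nat \<Rightarrow> complex" and r
  where "r < 1" "\<And>k. norm (T k) \<le> r" "\<And>k. norm (A k) \<le> r" "\<And>k. norm (B k) \<le> r"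
    "\<And>k. norm (C k) \<le> r" "\<And>k. norm (D k) \<le> r"
    "\<And>k. T k \<noteq> 0" "\<And>k. distinct [A k, B k, C k, D k]"
    "T \<longlonglongrightarrow> t" "A \<longlonglongrightarrow> a" "B \<longlonglongrightarrow> b" "C \<longlonglongrightarrow> c" "D \<longlonglongrightarrow> d"
proof -
  define \<epsilon> :: "nat \<Rightarrow> complex" where "\<epsilon> k = of_real (inverse (real (Suc k)))" for k
  have eps: "filterlim \<epsilon> (at 0) sequentially"
  proof -
    have "\<epsilon> \<longlonglongrightarrow> of_real 0" unfolding \<epsilon>_def by (intro tendsto_of_real LIMSEQ_inverse_real_of_nat)
    moreover have "\<epsilon> k \<noteq> 0" for k unfolding \<epsilon>_def of_real_eq_0_iff by simp
    ultimately show ?thesis by (simp add: filterlim_at)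
  qed
  have eps0: "\<epsilon> \<longlonglongrightarrow> 0" using eps by (simp add: filterlim_at)
  have lim: "(\<lambda>k. p + of_nat j * \<epsilon> k) \<longlonglongrightarrow> p" for p j
    using tendsto_add[OF tendsto_const[of p] tendsto_mult_right_zero[OF eps0, of "of_nat j"]] by simp
  \<comment> \<open>the midpoint between the largest modulus and \<open>1\<close> leaves room for the perturbation\<close>
  define r where "r = (1 + Max {norm t, norm a, norm b, norm c, norm d}) / 2"
  have r: "r < 1" "norm t < r" "norm a < r" "norm b < r" "norm c < r" "norm d < r"
    using assms by (auto simp: r_def less_max_iff_disj field_simps)
  have small: "eventually (\<lambda>k. norm (p + of_nat j * \<epsilon> k) < r) sequentially" if "norm p < r" for p j
    using order_tendstoD(2)[OF tendsto_norm[OF lim] that] .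
  have sep: "eventually (\<lambda>k. p + of_nat i * \<epsilon> k \<noteq> q + of_nat j * \<epsilon> k) sequentially" if "i \<noteq> j" for p q i j
  proof -
    have "eventually (\<lambda>x::complex. x \<noteq> (p - q) / (of_nat j - of_nat i)) (at 0)"
      by (rule eventually_neq_at_within)
    then have "eventually (\<lambda>k. \<epsilon> k \<noteq> (p - q) / (of_nat j - of_nat i)) sequentially"
      using eps by (rule eventually_compose_filterlim)
    then show ?thesis
      by eventually_elim (use that in \<open>auto simp: field_simps\<close>)
  qed
  have "eventually (\<lambda>k. norm (t + of_nat 1 * \<epsilon> k) < r \<and> norm (a + of_nat 1 * \<epsilon> k) < r \<and>
      norm (b + of_nat 2 * \<epsilon> k) < r \<and> norm (c + of_nat 3 * \<epsilon> k) < r \<and> norm (d + of_nat 4 * \<epsilon> k) < r \<and>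
      t + of_nat 1 * \<epsilon> k \<noteq> 0 + of_nat 0 * \<epsilon> k \<and>
      distinct [a + of_nat 1 * \<epsilon> k, b + of_nat 2 * \<epsilon> k, c + of_nat 3 * \<epsilon> k, d + of_nat 4 * \<epsilon> k]) sequentially"
    unfolding distinct.simps list.set insert_iff empty_iff de_Morgan_disj simp_thms
    by (intro eventually_conj small sep r) simp_all
  then obtain N where N: "\<And>k. norm (t + of_nat 1 * \<epsilon> (k + N)) < r \<and> norm (a + of_nat 1 * \<epsilon> (k + N)) < r \<and>
      norm (b + of_nat 2 * \<epsilon> (k + N)) < r \<and> norm (c + of_nat 3 * \<epsilon> (k + N)) < r \<and> norm (d + of_nat 4 * \<epsilon> (k + N)) < r \<and>
      t + of_nat 1 * \<epsilon> (k + N) \<noteq> 0 + of_nat 0 * \<epsilon> (k + N) \<and>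
      distinct [a + of_nat 1 * \<epsilon> (k + N), b + of_nat 2 * \<epsilon> (k + N), c + of_nat 3 * \<epsilon> (k + N), d + of_nat 4 * \<epsilon> (k + N)]"
    unfolding eventually_sequentially by (meson le_add2)
  define T A B C D where "T k = t + of_nat 1 * \<epsilon> (k + N)" and "A k = a + of_nat 1 * \<epsilon> (k + N)"
    and "B k = b + of_nat 2 * \<epsilon> (k + N)" and "C k = c + of_nat 3 * \<epsilon> (k + N)" and "D k = d + of_nat 4 * \<epsilon> (k + N)" for k
  note params = T_def A_def B_def C_def D_def
  have lims: "T \<longlonglongrightarrow> t" "A \<longlonglongrightarrow> a" "B \<longlonglongrightarrow> b" "C \<longlonglongrightarrow> c" "D \<longlonglongrightarrow> d"
    unfolding params by (intro LIMSEQ_ignore_initial_segment[OF lim])+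
  have lt: "norm (T k) < r" "norm (A k) < r" "norm (B k) < r" "norm (C k) < r" "norm (D k) < r"
    and gen: "T k \<noteq> 0" "distinct [A k, B k, C k, D k]" for k
    using N[of k] unfolding params by simp_all
  show ?thesis
    by (rule that[OF r(1) lt[THEN less_imp_le] gen lims])
qed

text \<open>
Induction on the number of variables. In each step the recursion gives the formula for distinct \<open>a, b, c, d\<close>
and \<open>t \<noteq> 0\<close>, and both sides are continuous in the parameters.
\<close>

lemma bc_density_integral:
  assumes "finite I" and "norm t < 1" "norm a < 1" "norm b < 1" "norm c < 1" "norm d < 1"
  shows "(LINT z|(\<Pi>\<^sub>M j\<in>I. circle_measure). bc_density I t a b c d z)
    = 2 ^ card I * fact (card I) * gustafson_value (card I) t a b c d"
  using assms
proof (induction "card I" arbitrary: I t a b c d)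
  case 0
  then have "I = {}" by simp
  then show ?case
    by (simp add: bc_density_def gustafson_value_def q_pochhammer_def PiM_empty lebesgue_integral_count_space_finite)
next
  case (Suc m)
  let ?S = "\<lambda>t a b c d. LINT z|(\<Pi>\<^sub>M j\<in>I. circle_measure). bc_density I t a b c d z"
  let ?V = "\<lambda>t a b c d. 2 ^ card I * fact (card I) * gustafson_value (card I) t a b c d"
  have I: "finite I" "I \<noteq> {}" using Suc by auto
  have generic: "?S t a b c d = ?V t a b c d"
    if t: "t \<noteq> 0" "norm t < 1" and n: "norm a < 1" "norm b < 1" "norm c < 1" "norm d < 1"
      and dist: "distinct [a, b, c, d]" for t a b c d
  proof -
    let ?C = "(1 + t ^ m) * (1 - t ^ Suc m)"
    have IH: "(LINT z|(\<Pi>\<^sub>M j\<in>I-{k}. circle_measure). bc_density (I - {k}) t (t * p) b' c' d' z)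
        = 2 ^ m * fact m * gustafson_value m t (t * p) b' c' d'"
      if "k \<in> I" "norm p < 1" "norm b' < 1" "norm c' < 1" "norm d' < 1" for k p b' c' d'
    proof -
      have "m = card (I - {k})" using Suc.hyps(2) that(1) I by simp
      then show ?thesis using Suc.hyps(1)[of "I - {k}" t "t * p" b' c' d'] I that t norm_mult_less_1 by simp
    qed
    let ?R = "site_residue a b c d * gustafson_value m t (t * a) b c d
      + site_residue b a c d * gustafson_value m t (t * b) a c d
      + site_residue c b a d * gustafson_value m t (t * c) b a d
      + site_residue d b c a * gustafson_value m t (t * d) b c a"
    have "?C * ?S t a b c d = (1 - t) * (\<Sum>k\<in>I. 2 * (2 ^ m * fact m * ?R))"
      using bc_density_integral_recursion[OF I t n dist] n
      by (simp add: Suc.hyps(2)[symmetric] IH distrib_left mult.left_commute cong: sum.cong)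
    also have "\<dots> = (2 ^ card I * fact (card I)) * ((1 - t) * ?R)"
      by (simp add: Suc.hyps(2)[symmetric])
    also have "\<dots> = ?C * ?V t a b c d"
      unfolding sum_site_residues_gustafson[OF t(2) n dist] Suc.hyps(2)[symmetric] by (simp only: mult_ac)
    finally have "?C * ?S t a b c d = ?C * ?V t a b c d" .
    \<comment> \<open>for \<open>m = 0\<close> this factor is \<open>2\<close>; otherwise its second term has modulus less than \<open>1\<close>\<close>
    moreover have "1 + t ^ m \<noteq> 0"
    proof (cases m)
      case (Suc i)
      then have "norm (- (t ^ m)) < 1" using t by (simp only: norm_minus_cancel norm_power) (rule power_Suc_less_one, auto)
      then have "1 - (- (t ^ m)) \<noteq> 0" by (rule one_minus_nonzero)
      then show ?thesis by simp
    qed simp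
    moreover have "norm (t ^ Suc m) < 1" unfolding norm_power using t by (intro power_Suc_less_one) auto
    then have "1 - t ^ Suc m \<noteq> 0" by (rule one_minus_nonzero)
    ultimately show ?thesis by simp
  qed
  obtain T A B C D r where r: "r < 1"
    and bound: "\<And>k. norm (T k) \<le> r" "\<And>k. norm (A k) \<le> r" "\<And>k. norm (B k) \<le> r"
      "\<And>k. norm (C k) \<le> r" "\<And>k. norm (D k) \<le> r"
    and gen: "\<And>k. T k \<noteq> 0" "\<And>k. distinct [A k, B k, C k, D k]"
    and lims: "T \<longlonglongrightarrow> t" "A \<longlonglongrightarrow> a" "B \<longlonglongrightarrow> b" "C \<longlonglongrightarrow> c" "D \<longlonglongrightarrow> d"
    using generic_parameters_dense[OF Suc.prems(2-6)] by metis
  have "(\<lambda>k. ?S (T k) (A k) (B k) (C k) (D k)) \<longlonglongrightarrow> ?S t a b c d"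
    by (rule bc_density_integral_tendsto[OF I(1) r bound lims])
  moreover have "?S (T k) (A k) (B k) (C k) (D k) = ?V (T k) (A k) (B k) (C k) (D k)" for k
    by (intro generic gen le_less_trans[OF bound(1) r] le_less_trans[OF bound(2) r] le_less_trans[OF bound(3) r]
        le_less_trans[OF bound(4) r] le_less_trans[OF bound(5) r])
  ultimately have "(\<lambda>k. ?V (T k) (A k) (B k) (C k) (D k)) \<longlonglongrightarrow> ?S t a b c d" by simp
  moreover have "(\<lambda>k. ?V (T k) (A k) (B k) (C k) (D k)) \<longlonglongrightarrow> ?V t a b c d"
    by (intro tendsto_intros gustafson_value_tendsto lims Suc.prems)
  ultimately show ?case by (rule LIMSEQ_unique)
qed

theorem theorem2p7:
  fixes n :: nat and t a b c d :: complex
  assumes "n \<ge> 1"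
    and "norm t < 1" and "norm a < 1" and "norm b < 1" and "norm c < 1" and "norm d < 1"
  shows "(LINT z|torus_measure n. koornwinder_density n z t a b c d) =
    (\<Prod>i\<in>{0..n-1}. 1 / ((1 - t^i * a * c) * (1 - t^i * b * c) * (1 - t^i * c * d) *
                        (1 - t^i * a * d) * (1 - t^i * b * d) * (1 - t^i * a * b))) *
    (\<Prod>j\<in>{0..n-1}. 1 - t^(2*n - 2 - j) * a * b * c * d) *
    (\<Prod>j\<in>{1..n}. (1 - t) / (1 - t^j))"
proof -
  have pairs: "{(i, j). 1 \<le> i \<and> i < j \<and> j \<le> n} = {(i, j). i \<in> {1..n} \<and> j \<in> {1..n} \<and> i < j}"
    by auto
  have kernel: "(1 - x * y) * (1 - inverse x * inverse y) * (1 - inverse x * y) * (1 - x * inverse y) /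
      ((1 - t * x * y) * (1 - t * inverse x * inverse y) * (1 - t * inverse x * y) * (1 - t * x * inverse y))
      = half_kernel t x y * half_kernel t (inverse x) y" for x y
    by (simp add: half_kernel_def mult_ac)
  have "koornwinder_density n z t a b c d = 1 / (2 ^ n * fact n) * bc_density {1..n} t a b c d z" for z
    unfolding koornwinder_density_def bc_density_def site_weight_def kernel pairs by (rule mult.assoc)
  then have "(LINT z|torus_measure n. koornwinder_density n z t a b c d)
      = 1 / (2 ^ n * fact n) * (LINT z|(\<Pi>\<^sub>M j\<in>{1..n}. circle_measure). bc_density {1..n} t a b c d z)"
    by (simp add: torus_measure_def)
  also have "\<dots> = gustafson_value n t a b c d"
    using assms by (simp add: bc_density_integral)
  also have "\<dots> = (\<Prod>i\<in>{0..n-1}. 1 / ((1 - t^i * a * c) * (1 - t^i * b * c) * (1 - t^i * c * d) *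
                        (1 - t^i * a * d) * (1 - t^i * b * d) * (1 - t^i * a * b))) *
    (\<Prod>j\<in>{0..n-1}. 1 - t^(2*n - 2 - j) * a * b * c * d) *
    (\<Prod>j\<in>{1..n}. (1 - t) / (1 - t^j))"
  proof -
    have range: "{0..n-1} = {..<n}" using assms(1) by auto
    have "(\<Prod>j<n. 1 - t^(2*n - 2 - j) * a * b * c * d) = (\<Prod>j<n. 1 - t^(2*n - 2 - (n - Suc j)) * a * b * c * d)"
      by (rule prod.nat_diff_reindex[symmetric])
    also have "\<dots> = q_pochhammer t (t ^ (n - 1) * (a*b*c*d)) n"
      unfolding q_pochhammer_def
    proof (rule prod.cong[OF refl])
      fix j assume "j \<in> {..<n}"
      then have "2*n - 2 - (n - Suc j) = j + (n - 1)" by auto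
      then show "1 - t^(2*n - 2 - (n - Suc j)) * a * b * c * d = 1 - t ^ j * (t ^ (n - 1) * (a*b*c*d))"
        by (simp only: power_add mult_ac)
    qed
    finally show ?thesis
      unfolding gustafson_value_def range
      by (simp add: q_pochhammer_def prod.distrib prod_dividef mult_ac)
  qed
  finally show ?thesis .
qed

end
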